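(* Let $k,n$ be positive integers with $n\ge 2k$, and let $\mathcal{F}=\ast_{\alpha\in I}G_\alpha$ be the free product of groups $G_\alpha$, $\alpha\in I$, that contain no nontrivial elements of order $\le n$. If $x_1,y_1,\dots,x_k,y_k,z\in\mathcal{F}$ satisfy $$[x_1,y_1]\cdots[x_k,y_k]=z^n$$ in $\mathcal{F}$, then $z$ is conjugate in $\mathcal{F}$ to an element of a free factor $G_\alpha$ of $\mathcal{F}$.
   Context: $[x,y]=x^{-1}y^{-1}xy$. *)

theory Defs
  imports "HOL-Algebra.Multiplicative_Group"
begin

definition commutator :: "('a, 'b) monoid_scheme \<Rightarrow> 'a \<Rightarrow> 'a \<Rightarrow> 'a" where
  "commutator G x y = inv\<^bsub>G\<^esub> x \<otimes>\<^bsub>G\<^esub> inv\<^bsub>G\<^esub> y \<otimes>\<^bsub>G\<^esub> x \<otimes>\<^bsub>G\<^esub> y"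

definition conjugate_in :: "('a, 'b) monoid_scheme \<Rightarrow> 'a \<Rightarrow> 'a \<Rightarrow> bool" where
  "conjugate_in G a b \<longleftrightarrow> (\<exists>c \<in> carrier G. a = inv\<^bsub>G\<^esub> c \<otimes>\<^bsub>G\<^esub> b \<otimes>\<^bsub>G\<^esub> c)"

definition list_mult :: "('a, 'b) monoid_scheme \<Rightarrow> 'a list \<Rightarrow> 'a" where
  "list_mult G xs = foldr (\<otimes>\<^bsub>G\<^esub>) xs \<one>\<^bsub>G\<^esub>"

text \<open>
  The free product is the group of reduced words. A letter is an index paired with a
  nontrivial element of the group with that index, and adjacent letters have different
  indices. The product concatenates two words and reduces the result: the letters of the
  left factor are put in front of the right factor one at a time, starting with the last.
\<close>

definition reduced_words :: "('i \<Rightarrow> ('a, 'b) monoid_scheme) \<Rightarrow> 'i set \<Rightarrow> ('i \<times> 'a) list set" where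
  "reduced_words G I =
    {w. (\<forall>(i, g) \<in> set w. i \<in> I \<and> g \<in> carrier (G i) \<and> g \<noteq> \<one>\<^bsub>G i\<^esub>) \<and>
        successively (\<lambda>p q. fst p \<noteq> fst q) w}"

definition fp_incl :: "('i \<Rightarrow> ('a, 'b) monoid_scheme) \<Rightarrow> 'i \<Rightarrow> 'a \<Rightarrow> ('i \<times> 'a) list" where
  "fp_incl G i g = (if g = \<one>\<^bsub>G i\<^esub> then [] else [(i, g)])"

fun fp_cons :: "('i \<Rightarrow> ('a, 'b) monoid_scheme) \<Rightarrow> 'i \<times> 'a \<Rightarrow> ('i \<times> 'a) list \<Rightarrow> ('i \<times> 'a) list" where
  "fp_cons G (i, g) [] = fp_incl G i g"
| "fp_cons G (i, g) ((j, h) # w) =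
    (if i = j then fp_incl G i (g \<otimes>\<^bsub>G i\<^esub> h) @ w else fp_incl G i g @ (j, h) # w)"

definition free_product ::
  "('i \<Rightarrow> ('a, 'b) monoid_scheme) \<Rightarrow> 'i set \<Rightarrow> ('i \<times> 'a) list monoid" where
  "free_product G I =
    \<lparr>carrier = reduced_words G I, mult = (\<lambda>u v. foldr (fp_cons G) u v), one = []\<rparr>"

lemma free_product_simps:
  "carrier (free_product G I) = reduced_words G I"
  "u \<otimes>\<^bsub>free_product G I\<^esub> v = foldr (fp_cons G) u v"
  "\<one>\<^bsub>free_product G I\<^esub> = []"
  by (simp_all add: free_product_def)

lemma reduced_words_Nil: "[] \<in> reduced_words G I"
  by (simp add: reduced_words_def)

lemma reduced_words_Cons:
  "(i, g) # w \<in> reduced_words G I \<longleftrightarrow>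
    i \<in> I \<and> g \<in> carrier (G i) \<and> g \<noteq> \<one>\<^bsub>G i\<^esub> \<and> w \<in> reduced_words G I \<and>
    (w = [] \<or> fst (hd w) \<noteq> i)"
  by (cases w) (auto simp: reduced_words_def)

context
  fixes G :: "'i \<Rightarrow> ('a, 'b) monoid_scheme" and I :: "'i set"
  assumes grp: "\<And>i. i \<in> I \<Longrightarrow> group (G i)"
begin

lemma fp_cons_closed:
  assumes "i \<in> I" "g \<in> carrier (G i)" "w \<in> reduced_words G I"
  shows "fp_cons G (i, g) w \<in> reduced_words G I"
proof -
  interpret group "G i" using grp assms(1) .
  show ?thesis
    using assms by (cases w) (auto simp: fp_incl_def reduced_words_Cons reduced_words_Nil)
qed

lemma fp_cons_one:
  assumes "i \<in> I" "w \<in> reduced_words G I"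
  shows "fp_cons G (i, \<one>\<^bsub>G i\<^esub>) w = w"
proof -
  interpret group "G i" using grp assms(1) .
  show ?thesis
    using assms by (cases w) (auto simp: fp_incl_def reduced_words_Cons)
qed

lemma fp_cons_cons:
  assumes "i \<in> I" "g \<in> carrier (G i)" "h \<in> carrier (G i)" "w \<in> reduced_words G I"
  shows "fp_cons G (i, g) (fp_cons G (i, h) w) = fp_cons G (i, g \<otimes>\<^bsub>G i\<^esub> h) w"
proof -
  interpret group "G i" using grp assms(1) .
  show ?thesis
  proof (cases w)
    case Nil
    then show ?thesis using assms by (auto simp: fp_incl_def)
  next
    case (Cons p v)
    obtain j l where p: "p = (j, l)" by (cases p)
    show ?thesis
    proof (cases "j = i")
      case True
      have v: "v = [] \<or> fst (hd v) \<noteq> i" "l \<in> carrier (G i)" "l \<noteq> \<one>\<^bsub>G i\<^esub>"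
        using assms Cons p True by (auto simp: reduced_words_Cons)
      have "g \<otimes>\<^bsub>G i\<^esub> h \<otimes>\<^bsub>G i\<^esub> l = g" if "h \<otimes>\<^bsub>G i\<^esub> l = \<one>\<^bsub>G i\<^esub>"
        using that assms v by (simp add: m_assoc)
      then show ?thesis
        using assms Cons p True v by (cases v) (auto simp: fp_incl_def m_assoc)
    next
      case False
      then show ?thesis
        using assms Cons p by (auto simp: fp_incl_def)
    qed
  qed
qed

lemma fp_mult_closed:
  assumes "u \<in> reduced_words G I" "v \<in> reduced_words G I"
  shows "foldr (fp_cons G) u v \<in> reduced_words G I"
  using assms by (induction u) (auto simp: reduced_words_Cons intro: fp_cons_closed)

lemma fp_mult_cons:
  assumes "i \<in> I" "g \<in> carrier (G i)" "u \<in> reduced_words G I" "v \<in> reduced_words G I"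
  shows "foldr (fp_cons G) (fp_cons G (i, g) u) v = fp_cons G (i, g) (foldr (fp_cons G) u v)"
proof -
  interpret group "G i" using grp assms(1) .
  show ?thesis
  proof (cases u)
    case Nil
    then show ?thesis using assms by (auto simp: fp_incl_def fp_cons_one)
  next
    case (Cons p w)
    obtain j h where p: "p = (j, h)" by (cases p)
    have w: "w \<in> reduced_words G I" "h \<in> carrier (G j)" "j \<in> I"
      using assms Cons p by (auto simp: reduced_words_Cons)
    have wv: "foldr (fp_cons G) w v \<in> reduced_words G I"
      "fp_cons G (j, h) (foldr (fp_cons G) w v) \<in> reduced_words G I"
      using assms w by (auto intro!: fp_mult_closed fp_cons_closed)
    show ?thesis
    proof (cases "i = j")
      case True
      have "fp_cons G (i, g) (fp_cons G (i, h) (foldr (fp_cons G) w v)) =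
          fp_cons G (i, g \<otimes>\<^bsub>G i\<^esub> h) (foldr (fp_cons G) w v)"
        using assms w wv True by (intro fp_cons_cons) auto
      then show ?thesis
        using assms Cons p True wv by (auto simp: fp_incl_def fp_cons_one)
    next
      case False
      then show ?thesis
        using assms Cons p wv by (auto simp: fp_incl_def fp_cons_one)
    qed
  qed
qed

lemma fp_mult_assoc:
  assumes "u \<in> reduced_words G I" "v \<in> reduced_words G I" "w \<in> reduced_words G I"
  shows "foldr (fp_cons G) (foldr (fp_cons G) u v) w =
    foldr (fp_cons G) u (foldr (fp_cons G) v w)"
  using assms(1)
proof (induction u)
  case Nil
  then show ?case by simp
next
  case (Cons p u)
  obtain i g where p: "p = (i, g)" by (cases p)
  show ?case
    using Cons assms(2,3) by (simp add: p reduced_words_Cons fp_mult_cons fp_mult_closed)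
qed

lemma fp_left_inverse:
  assumes "w \<in> reduced_words G I"
  shows "\<exists>u \<in> reduced_words G I. foldr (fp_cons G) u w = []"
  using assms
proof (induction w)
  case Nil
  show ?case by (rule bexI[of _ "[]"]) (simp_all add: reduced_words_Nil)
next
  case (Cons p w)
  obtain i g where p: "p = (i, g)" by (cases p)
  have g: "i \<in> I" "g \<in> carrier (G i)" "g \<noteq> \<one>\<^bsub>G i\<^esub>" "w \<in> reduced_words G I"
    using Cons.prems by (auto simp: p reduced_words_Cons)
  interpret group "G i" using grp g(1) .
  obtain u where u: "u \<in> reduced_words G I" "foldr (fp_cons G) u w = []"
    using Cons g by blast
  have i: "[(i, inv\<^bsub>G i\<^esub> g)] \<in> reduced_words G I"
    using g by (simp add: reduced_words_Cons reduced_words_Nil inv_eq_1_iff)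
  have "foldr (fp_cons G) (foldr (fp_cons G) u [(i, inv\<^bsub>G i\<^esub> g)]) (p # w) =
      foldr (fp_cons G) u (foldr (fp_cons G) [(i, inv\<^bsub>G i\<^esub> g)] (p # w))"
    using u i Cons.prems by (intro fp_mult_assoc)
  also have "\<dots> = []"
    using u g by (simp add: p fp_incl_def)
  finally show ?case
    using fp_mult_closed[OF u(1) i] by blast
qed

theorem group_free_product: "group (free_product G I)"
  by (rule groupI)
    (simp_all add: free_product_simps fp_mult_closed fp_mult_assoc reduced_words_Nil
      fp_left_inverse)

lemma fp_incl_hom:
  assumes "i \<in> I"
  shows "fp_incl G i \<in> hom (G i) (free_product G I)"
proof -
  interpret group "G i" using grp assms .
  show ?thesis
    using assms
    by (auto simp: hom_def free_product_simps fp_incl_def reduced_words_Cons reduced_words_Nil)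
qed

lemma fp_incl_inj: "inj_on (fp_incl G i) (carrier (G i))"
  by (auto simp: inj_on_def fp_incl_def split: if_splits)

text \<open>The group of reduced words is the coproduct of the family.\<close>

theorem free_product_universal:
  assumes H: "group H" and \<phi>: "\<And>i. i \<in> I \<Longrightarrow> \<phi> i \<in> hom (G i) H"
  shows "\<exists>f \<in> hom (free_product G I) H.
      (\<forall>i \<in> I. \<forall>g \<in> carrier (G i). f (fp_incl G i g) = \<phi> i g) \<and>
      (\<forall>f' \<in> hom (free_product G I) H.
        (\<forall>i \<in> I. \<forall>g \<in> carrier (G i). f' (fp_incl G i g) = \<phi> i g) \<longrightarrow>
        (\<forall>w \<in> carrier (free_product G I). f' w = f w))"
proof -
  interpret H: group H by (rule H)
  interpret F: group "free_product G I" by (rule group_free_product)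
  define f where "f w = foldr (\<lambda>(i, g) h. \<phi> i g \<otimes>\<^bsub>H\<^esub> h) w \<one>\<^bsub>H\<^esub>" for w
  have f_simps: "f [] = \<one>\<^bsub>H\<^esub>" "f ((i, g) # w) = \<phi> i g \<otimes>\<^bsub>H\<^esub> f w" for i g w
    by (simp_all add: f_def)
  have \<phi>c: "\<phi> i g \<in> carrier H" if "i \<in> I" "g \<in> carrier (G i)" for i g
    using \<phi>[OF that(1)] that(2) by (auto simp: hom_def)
  have \<phi>1: "\<phi> i \<one>\<^bsub>G i\<^esub> = \<one>\<^bsub>H\<^esub>" if "i \<in> I" for i
    using hom_one[OF \<phi>[OF that] grp[OF that] H] .
  have \<phi>m: "\<phi> i (g \<otimes>\<^bsub>G i\<^esub> h) = \<phi> i g \<otimes>\<^bsub>H\<^esub> \<phi> i h"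
    if "i \<in> I" "g \<in> carrier (G i)" "h \<in> carrier (G i)" for i g h
    using \<phi>[OF that(1)] that by (auto simp: hom_def)
  have fc: "f w \<in> carrier H" if "w \<in> reduced_words G I" for w
    using that by (induction w) (auto simp: f_simps reduced_words_Cons \<phi>c)
  have f_incl_app: "f (fp_incl G i g @ w) = \<phi> i g \<otimes>\<^bsub>H\<^esub> f w"
    if "i \<in> I" "w \<in> reduced_words G I" for i g w
    using that by (auto simp: fp_incl_def f_simps \<phi>1 fc)
  have f_cons: "f (fp_cons G (i, g) w) = \<phi> i g \<otimes>\<^bsub>H\<^esub> f w"
    if "i \<in> I" "g \<in> carrier (G i)" "w \<in> reduced_words G I" for i g w
  proof (cases w)
    case Nil
    then show ?thesis
      using f_incl_app[of i "[]" g] that by (simp add: reduced_words_Nil)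
  next
    case (Cons p v)
    obtain j h where p: "p = (j, h)" by (cases p)
    have v: "v \<in> reduced_words G I" "j \<in> I" "h \<in> carrier (G j)"
      using that Cons p by (auto simp: reduced_words_Cons)
    show ?thesis
      using that v Cons p f_incl_app
      by (auto simp: \<phi>m f_simps H.m_assoc \<phi>c fc)
  qed
  have f_mult: "f (foldr (fp_cons G) u v) = f u \<otimes>\<^bsub>H\<^esub> f v"
    if "u \<in> reduced_words G I" "v \<in> reduced_words G I" for u v
    using that(1)
  proof (induction u)
    case Nil
    then show ?case using that by (simp add: f_simps fc)
  next
    case (Cons p u)
    obtain i g where p: "p = (i, g)" by (cases p)
    show ?case
      using Cons that(2)
      by (auto simp: p reduced_words_Cons f_cons fp_mult_closed f_simps H.m_assoc \<phi>c fc)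
  qed
  have f_hom: "f \<in> hom (free_product G I) H"
    by (auto simp: hom_def free_product_simps fc f_mult)
  have f_incl: "f (fp_incl G i g) = \<phi> i g" if "i \<in> I" "g \<in> carrier (G i)" for i g
    using f_incl_app[of i "[]" g] that by (simp add: reduced_words_Nil f_simps \<phi>c)
  have uniq: "f' w = f w"
    if f': "f' \<in> hom (free_product G I) H"
      "\<And>i g. i \<in> I \<Longrightarrow> g \<in> carrier (G i) \<Longrightarrow> f' (fp_incl G i g) = \<phi> i g"
      and "w \<in> reduced_words G I" for f' w
    using that(3)
  proof (induction w)
    case Nil
    then show ?case
      using hom_one[OF f'(1) group_free_product H] by (simp add: free_product_simps f_simps)
  next
    case (Cons p w)
    obtain i g where p: "p = (i, g)" by (cases p)
    have g: "i \<in> I" "g \<in> carrier (G i)" "g \<noteq> \<one>\<^bsub>G i\<^esub>" "w \<in> reduced_words G I"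
      "w = [] \<or> fst (hd w) \<noteq> i"
      using Cons.prems by (auto simp: p reduced_words_Cons)
    have s: "[(i, g)] \<in> reduced_words G I"
      using g by (simp add: reduced_words_Cons reduced_words_Nil)
    have "p # w = [(i, g)] \<otimes>\<^bsub>free_product G I\<^esub> w"
      using g by (cases w) (auto simp: p free_product_simps fp_incl_def)
    then have "f' (p # w) = f' [(i, g)] \<otimes>\<^bsub>H\<^esub> f' w"
      using hom_mult[OF f'(1), of "[(i, g)]" w] s g by (simp only: free_product_simps)
    moreover have "f' [(i, g)] = \<phi> i g"
      using f'(2)[of i g] g by (simp add: fp_incl_def)
    ultimately show ?case
      using Cons.IH g by (simp add: p f_simps)
  qed
  show ?thesis
    using f_hom f_incl uniq by (intro bexI[of _ f]) (auto simp: free_product_simps)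
qed

end

end

theory Submission
  imports Defs "HOL-Combinatorics.Permutations"
begin

text \<open>
  If \<open>z\<close> is not conjugate into a factor, it may be taken cyclically reduced, of length
  \<open>l \<ge> 2\<close>. The equation is a map of a surface of genus \<open>k\<close> with one boundary component, reading
  \<open>z\<^sup>n\<close>, to a wedge of spaces, one for each factor. Cutting along the preimage of the
  base point leaves polygons, which map to one factor each and have the letters of \<open>z\<^sup>n\<close> and cutting
  arcs as sides, and regions that map to the base point. There are \<open>n l\<close> arcs, so at least
  \<open>n l + 1 - 2 k\<close> components are regions or disk polygons.

  Number the letters of \<open>z\<close> from \<open>0\<close> to \<open>l - 1\<close>. Along the boundary of a disk
  polygon this number must increase somewhere: otherwise it is constant, and a letter
  has a trivial power with exponent at most \<open>n\<close>. It also increases somewhere along each region,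
  since cyclically adjacent letters lie in different factors. An arc whose two sides join letter
  \<open>i\<close> to letter \<open>j\<close> of a polygon, and letter \<open>j - 1\<close> to letter \<open>i\<close> of a region, can be an increase
  on one side only, and on no side if \<open>j = 0\<close>. The latter happens \<open>n\<close> times, so there are at
  most \<open>n l - n\<close> disks and regions together, whence \<open>n \<le> 2 k - 1\<close>.
\<close>

section \<open>Cycles of permutations as lists\<close>

text \<open>For a nonempty distinct \<open>w\<close> this says that \<open>w\<close> lists one cycle
  of \<open>f\<close> in cyclic order. Lists are used instead of orbits because letters are
  multiplied in order. The empty list always qualifies.\<close>

definition cyc :: "('d \<Rightarrow> 'd) \<Rightarrow> 'd list \<Rightarrow> bool" where
  "cyc f w \<longleftrightarrow> map f w = rotate1 w"

definition del :: "'d \<Rightarrow> ('d \<Rightarrow> 'd) \<Rightarrow> 'd \<Rightarrow> 'd" where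
  "del d f = (\<lambda>x. if x = d then d else if f x = d then f d else f x)"

text \<open>
  Two boundary letters \<open>d\<close> and \<open>d'\<close> are identified with opposite orientations: the transposition
  makes the predecessor of each one precede the other, and then both are bypassed.
\<close>

definition glue :: "'d \<Rightarrow> 'd \<Rightarrow> ('d \<Rightarrow> 'd) \<Rightarrow> 'd \<Rightarrow> 'd" where
  "glue d d' f = del d' (del d (transpose d d' \<circ> f))"

lemma cyc_rotate: "cyc f (u @ v) \<Longrightarrow> cyc f (v @ u)"
proof -
  assume "cyc f (u @ v)"
  then have "map f (rotate (length u) (u @ v)) = rotate1 (rotate (length u) (u @ v))"
    by (simp only: cyc_def rotate_map[symmetric] rotate1_rotate_swap)
  then show ?thesis
    by (simp add: cyc_def rotate_append)
qed

lemma cyc_image: "cyc f w \<Longrightarrow> f ` set w = set w"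
  unfolding cyc_def by (metis list.set_map set_rotate1)

lemma cyc_Cons: "cyc f (d # v) \<longleftrightarrow> map f (d # v) = v @ [d]"
  by (simp add: cyc_def)

lemma cyc_del_other: "cyc f w \<Longrightarrow> d \<notin> set w \<Longrightarrow> cyc (del d f) w"
proof -
  assume a: "cyc f w" "d \<notin> set w"
  have "map (del d f) w = map f w"
    using cyc_image[OF a(1)] a(2) by (auto simp: del_def)
  then show ?thesis using a(1) by (metis cyc_def)
qed

lemma cyc_del_Cons:
  assumes "cyc f (d # v)" "d \<notin> set v"
  shows "cyc (del d f) v"
proof (cases v)
  case Nil
  then show ?thesis by (simp add: cyc_def)
next
  case (Cons a v')
  obtain s e where v: "v = s @ [e]" using Cons by (metis list.discI rev_exhaust)
  have "map f (d # s @ [e]) = (a # v') @ [d]"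
    using assms(1) Cons v by (simp only: cyc_Cons)
  then have eq: "f d = a" "map f s @ [f e] = v' @ [d]" by simp_all
  then have s: "map f s = v'" "f e = d" by auto
  have "del d f x = f x" if "x \<in> set s" for x
  proof -
    have "f x \<in> set v'" using that s(1) by force
    then have "f x \<noteq> d" using assms(2) Cons by auto
    moreover have "x \<noteq> d" using that assms(2) v by auto
    ultimately show ?thesis by (simp add: del_def)
  qed
  then have "map (del d f) s = map f s" by simp
  moreover have "del d f e = a" using eq s assms v by (auto simp: del_def)
  ultimately have "map (del d f) v = v' @ [a]" using s v by simp
  then show ?thesis using Cons by (simp add: cyc_def)
qed

text \<open>Composing with the transposition only redirects the two arrows that enter
  \<open>d\<close> and \<open>d'\<close>. On a single cycle this separates the stretches starting at
  \<open>d\<close> and \<open>d'\<close>; on two cycles it merges them.\<close>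

lemma cyc_transpose_cut:
  assumes "cyc f (d # A @ d' # B)" "distinct (d # A @ d' # B)"
  shows "cyc (transpose d d' \<circ> f) (d # A)" "cyc (transpose d d' \<circ> f) (d' # B)"
proof -
  have "map f (d # A) @ map f (d' # B) = (A @ [d']) @ (B @ [d])"
    using assms by (simp add: cyc_Cons)
  then have "map f (d # A) = A @ [d'] \<and> map f (d' # B) = B @ [d]"
    by (subst (asm) append_eq_append_conv) simp_all
  then have eq: "map f (d # A) = A @ [d']" "map f (d' # B) = B @ [d]" by simp_all
  have m: "map (transpose d d' \<circ> f) w = map (transpose d d') (map f w)" for w by simp
  have A: "map (transpose d d') A = A" "map (transpose d d') B = B"
    using assms(2) by (auto intro!: map_idI simp: transpose_def)
  show "cyc (transpose d d' \<circ> f) (d # A)" "cyc (transpose d d' \<circ> f) (d' # B)"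
    unfolding cyc_Cons m eq by (simp_all add: A)
qed

lemma cyc_transpose_join:
  assumes "cyc f (d # A)" "cyc f (d' # B)" "distinct (d # A @ d' # B)"
  shows "cyc (transpose d d' \<circ> f) (d # A @ d' # B)"
proof -
  have eq: "map f (d # A) = A @ [d]" "map f (d' # B) = B @ [d']"
    using assms by (simp_all only: cyc_Cons)
  have m: "map (transpose d d' \<circ> f) w = map (transpose d d') (map f w)" for w by simp
  have A: "map (transpose d d') A = A" "map (transpose d d') B = B"
    using assms(3) by (auto intro!: map_idI simp: transpose_def)
  have "map (transpose d d' \<circ> f) ((d # A) @ (d' # B)) = A @ [d'] @ B @ [d]"
    unfolding map_append m eq by (simp add: A)
  then show ?thesis by (simp add: cyc_Cons)
qed

lemma cyc_transpose_other:
  assumes "cyc f w" "d \<notin> set w" "d' \<notin> set w"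
  shows "cyc (transpose d d' \<circ> f) w"
proof -
  have "map (transpose d d' \<circ> f) w = map f w"
    using cyc_image[OF assms(1)] assms by (auto simp: transpose_def)
  then show ?thesis using assms(1) by (metis cyc_def)
qed

lemma cyc_glue_other:
  assumes "cyc f w" "d \<notin> set w" "d' \<notin> set w"
  shows "cyc (glue d d' f) w"
  unfolding glue_def using assms by (intro cyc_del_other cyc_transpose_other)

text \<open>Topologically, identifying two letters of one boundary curve divides the curve in two.
  The same fact serves for the polygons, since \<open>p\<close> is glued in the same way as
  \<open>s\<close>.\<close>

lemma cyc_glue_cut:
  assumes "cyc f (d # A @ d' # B)" "distinct (d # A @ d' # B)"
  shows "cyc (glue d d' f) A" "cyc (glue d d' f) B"
proof -
  note c = cyc_transpose_cut[OF assms]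
  have "cyc (del d (transpose d d' \<circ> f)) A" using c(1) assms(2) by (intro cyc_del_Cons) auto
  then show "cyc (glue d d' f) A" unfolding glue_def using assms(2) by (auto intro: cyc_del_other)
  have "cyc (del d (transpose d d' \<circ> f)) (d' # B)" using c(2) assms(2) by (intro cyc_del_other) auto
  then show "cyc (glue d d' f) B" unfolding glue_def using assms(2) by (auto intro: cyc_del_Cons)
qed

lemma cyc_glue_join:
  assumes "cyc f (d # A)" "cyc f (d' # B)" "distinct (d # A @ d' # B)"
  shows "cyc (glue d d' f) (A @ B)"
proof -
  have "cyc (del d (transpose d d' \<circ> f)) (A @ d' # B)"
    using cyc_transpose_join[OF assms] assms by (intro cyc_del_Cons) auto
  from cyc_rotate[OF this] have "cyc (del d' (del d (transpose d d' \<circ> f))) (B @ A)"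
    using assms(3) by (auto intro: cyc_del_Cons)
  then show ?thesis unfolding glue_def by (rule cyc_rotate)
qed

lemma del_permutes:
  assumes "f permutes Z" "d \<in> Z"
  shows "del d f permutes (Z - {d})"
proof -
  \<comment> \<open>As \<open>f\<close> is injective, bypassing \<open>d\<close> amounts to
    composing with a transposition.\<close>
  have eq: "del d f = transpose d (f d) \<circ> f"
    using permutes_inj[OF assms(1)] by (auto simp: del_def transpose_def fun_eq_iff inj_eq)
  have "transpose d (f d) \<circ> f permutes Z"
    using assms by (intro permutes_compose permutes_swap_id) (auto simp: permutes_in_image)
  then have "del d f permutes Z" by (simp add: eq)
  then show ?thesis
    by (rule permutes_superset) (auto simp: del_def)
qed

lemma glue_permutes:
  assumes "f permutes Z" "d \<in> Z" "d' \<in> Z" "d \<noteq> d'"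
  shows "glue d d' f permutes (Z - {d, d'})"
proof -
  have "transpose d d' \<circ> f permutes Z"
    using assms by (intro permutes_compose permutes_swap_id)
  then have "glue d d' f permutes (Z - {d} - {d'})"
    unfolding glue_def using assms by (intro del_permutes) auto
  moreover have "Z - {d} - {d'} = Z - {d, d'}" by auto
  ultimately show ?thesis by simp
qed

text \<open>The colouring \<open>h\<close> is constant on the cycles of \<open>p\<inverse> s\<close>, so it has at most as many values as cycles.\<close>

definition compatible :: "'d set \<Rightarrow> ('d \<Rightarrow> 'd) \<Rightarrow> ('d \<Rightarrow> 'd) \<Rightarrow> ('d \<Rightarrow> nat) \<Rightarrow> bool" where
  "compatible Z s p h \<longleftrightarrow> (\<forall>x \<in> Z. \<forall>y \<in> Z. p x = s y \<longrightarrow> h x = h y)"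

text \<open>Write \<open>f\<close> for the inverse of \<open>p\<close> after \<open>s\<close>.
  Deleting \<open>d\<close> either drops a fixed point of \<open>f\<close> or forces at most two
  colours to be merged, so at most one colour is lost. If exactly one of \<open>s\<close> and
  \<open>p\<close> fixes \<open>d\<close>, the colours to be merged already agree.\<close>

lemma compatible_del:
  assumes s: "s permutes Z" and p: "p permutes Z" and d: "d \<in> Z" and Z: "finite Z"
    and h: "compatible Z s p h"
  obtains h' where "compatible (Z - {d}) (del d s) (del d p) h'"
    "card (h ` Z) \<le> card (h' ` (Z - {d})) + 1"
    "(s d = d) \<noteq> (p d = d) \<longrightarrow> card (h ` Z) \<le> card (h' ` (Z - {d}))"
proof (cases "p d = s d")
  case True
  have ij: "s x = s y \<longleftrightarrow> x = y" "p x = p y \<longleftrightarrow> x = y" for x y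
    using permutes_inj[OF s] permutes_inj[OF p] by (auto simp: inj_eq)
  \<comment> \<open>Here \<open>d\<close> is a fixed point of the inverse of \<open>p\<close> after
    \<open>s\<close>, so the old colouring still works and only the colour of \<open>d\<close> can
    disappear.\<close>
  have "compatible (Z - {d}) (del d s) (del d p) h"
    unfolding compatible_def
  proof (intro ballI impI)
    fix x y assume xy: "x \<in> Z - {d}" "y \<in> Z - {d}" and e: "del d p x = del d s y"
    have "p x = s y"
    proof (cases "p x = d")
      case px: True
      have "s y = d"
      proof (rule ccontr)
        assume "s y \<noteq> d"
        then have "s d = s y" using e xy px True by (simp add: del_def)
        then show False using ij xy by simp
      qed
      then show ?thesis using px by simp
    next
      case px: False
      have "s y \<noteq> d"
      proof
        assume "s y = d"
        then have "p x = p d" using e xy px True by (simp add: del_def)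
        then show False using ij xy by simp
      qed
      then show ?thesis using e px xy by (simp add: del_def)
    qed
    then show "h x = h y" using h xy by (simp add: compatible_def)
  qed
  moreover have "card (h ` Z) \<le> card (h ` (Z - {d})) + 1"
  proof -
    have "h ` Z \<subseteq> insert (h d) (h ` (Z - {d}))" by auto
    then have "card (h ` Z) \<le> card (insert (h d) (h ` (Z - {d})))"
      using Z by (intro card_mono) auto
    also have "\<dots> \<le> card (h ` (Z - {d})) + 1"
      using Z by (simp add: card_insert_if)
    finally show ?thesis .
  qed
  ultimately show ?thesis using that[of h] True by auto
next
  case False
  have ij: "s x = s y \<longleftrightarrow> x = y" "p x = p y \<longleftrightarrow> x = y" for x y
    using permutes_inj[OF s] permutes_inj[OF p] by (auto simp: inj_eq)
  \<comment> \<open>The point \<open>a\<close> precedes \<open>d\<close> under \<open>p\<close>, and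
    \<open>q\<close> is the image of \<open>d\<close> under the inverse of \<open>p\<close> after
    \<open>s\<close>. Merging their two colours, which is the task of \<open>m\<close>, makes the
    colouring compatible after the deletion.\<close>
  obtain a where a: "a \<in> Z" "p a = d"
    using d permutes_image[OF p] by (metis imageE)
  obtain q where q: "q \<in> Z" "p q = s d"
    using permutes_in_image[OF s, of d] d permutes_image[OF p] by (metis imageE)
  have qd: "q \<noteq> d" using q False by auto
  have hq: "h q = h d" using h q d by (auto simp: compatible_def)
  define m where "m c = (if c = h a then h q else c)" for c
  have hh: "\<And>x y. x \<in> Z \<Longrightarrow> y \<in> Z \<Longrightarrow> p x = s y \<Longrightarrow> h x = h y"
    using h by (auto simp: compatible_def)
  have 1: "compatible (Z - {d}) (del d s) (del d p) (m \<circ> h)"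
    unfolding compatible_def
  proof (intro ballI impI)
    fix x y assume xy: "x \<in> Z - {d}" "y \<in> Z - {d}" and e: "del d p x = del d s y"
    show "(m \<circ> h) x = (m \<circ> h) y"
    proof (cases "p x = d")
      case True
      then have x: "x = a" using a ij by metis
      show ?thesis
      proof (cases "s y = d")
        case True
        then show ?thesis using hh[OF _ _ trans[OF \<open>p x = d\<close> True[symmetric]]] xy by simp
      next
        case False
        then have "p d = s y" using e \<open>p x = d\<close> xy by (simp add: del_def)
        then have "h y = h d" using hh[of d y] d xy by simp
        then show ?thesis using x hq by (simp add: m_def)
      qed
    next
      case px: False
      show ?thesis
      proof (cases "s y = d")
        case True
        then have "p x = s d" using e px xy by (auto simp: del_def)
        then have x: "x = q" using q ij by metis
        have "h a = h y" using hh[of a y] a True xy by simp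
        then show ?thesis using x by (simp add: m_def)
      next
        case False
        then have "p x = s y" using e px xy by (simp add: del_def)
        then have "h x = h y" using hh[of x y] xy by blast
        then show ?thesis by simp
      qed
    qed
  qed
  \<comment> \<open>The colour of \<open>d\<close> survives at \<open>q\<close>, so leaving out
    \<open>d\<close> costs nothing and only the merging can.\<close>
  have im: "h ` (Z - {d}) = h ` Z"
  proof -
    have "h d \<in> h ` (Z - {d})"
      using hq qd q(1) by (metis Diff_iff imageI singletonD)
    then have "insert (h d) (h ` (Z - {d})) = h ` (Z - {d})" by (rule insert_absorb)
    then show ?thesis using d by (metis image_insert insert_Diff)
  qed
  have imm: "(m \<circ> h) ` (Z - {d}) = m ` (h ` Z)" by (metis image_comp im)
  have "h ` Z \<subseteq> insert (h a) (m ` (h ` Z))" by (auto simp: m_def)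
  then have "card (h ` Z) \<le> card (insert (h a) (m ` (h ` Z)))"
    using Z by (intro card_mono) auto
  also have "\<dots> \<le> card (m ` (h ` Z)) + 1"
    using Z by (simp add: card_insert_if)
  finally have 2: "card (h ` Z) \<le> card ((m \<circ> h) ` (Z - {d})) + 1"
    by (simp only: imm)
  have 3: "card (h ` Z) \<le> card ((m \<circ> h) ` (Z - {d}))" if "(s d = d) \<noteq> (p d = d)"
  proof -
    \<comment> \<open>If \<open>s\<close> fixes \<open>d\<close>, then \<open>a\<close> and
      \<open>q\<close> are both the preimage of \<open>d\<close> under \<open>p\<close>. If
      \<open>p\<close> fixes \<open>d\<close>, then \<open>a\<close> is \<open>d\<close>, which has
      the colour of \<open>q\<close>.\<close>
    have "h a = h q"
    proof (cases "s d = d")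
      case True
      then have "a = q" using a q ij by metis
      then show ?thesis by simp
    next
      case False
      then have "a = d" using that a ij by metis
      then show ?thesis using hq by simp
    qed
    then have "m = id" by (auto simp: m_def)
    then show ?thesis by (simp add: im)
  qed
  show ?thesis by (rule that[OF 1 2]) (use 3 in blast)
qed

section \<open>Removing a pair of inverse letters\<close>

context group
begin

lemma list_mult_Nil: "list_mult G [] = \<one>"
  by (simp add: list_mult_def)

lemma list_mult_Cons: "list_mult G (a # w) = a \<otimes> list_mult G w"
  by (simp add: list_mult_def)

lemma list_mult_closed: "set w \<subseteq> carrier G \<Longrightarrow> list_mult G w \<in> carrier G"
  by (induction w) (auto simp: list_mult_Nil list_mult_Cons)

lemma list_mult_append:
  "set u \<subseteq> carrier G \<Longrightarrow> set v \<subseteq> carrier G \<Longrightarrow>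
    list_mult G (u @ v) = list_mult G u \<otimes> list_mult G v"
  by (induction u) (auto simp: list_mult_Nil list_mult_Cons list_mult_closed m_assoc)

lemma list_mult_rotate:
  assumes "set u \<subseteq> carrier G" "set v \<subseteq> carrier G" "list_mult G (u @ v) = \<one>"
  shows "list_mult G (v @ u) = \<one>"
proof -
  have "list_mult G u \<otimes> list_mult G v = \<one>"
    using assms by (simp only: list_mult_append)
  then have "list_mult G v \<otimes> list_mult G u = \<one>"
    using assms by (auto intro: inv_comm[of "list_mult G u"] list_mult_closed)
  then show ?thesis using assms by (simp only: list_mult_append)
qed

end

text \<open>A list singles out a first side of the polygon. The choice is immaterial, because a
  product equal to 1 keeps this value under rotation.\<close>

definition disk :: "('g, 'c) monoid_scheme \<Rightarrow> ('d \<Rightarrow> 'g) \<Rightarrow> ('d \<Rightarrow> 'd) \<Rightarrow> 'd set \<Rightarrow> 'd list \<Rightarrow> bool" where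
  "disk G val p Z P \<longleftrightarrow>
    P \<noteq> [] \<and> distinct P \<and> set P \<subseteq> Z \<and> cyc p P \<and> list_mult G (map val P) = \<one>\<^bsub>G\<^esub>"

text \<open>Disjointness also prevents a polygon from being counted twice through two rotations of
  its list.\<close>

definition disks :: "('g, 'c) monoid_scheme \<Rightarrow> ('d \<Rightarrow> 'g) \<Rightarrow> ('d \<Rightarrow> 'd) \<Rightarrow> 'd set \<Rightarrow> 'd list set \<Rightarrow> bool" where
  "disks G val p Z \<P> \<longleftrightarrow> finite \<P> \<and> (\<forall>P \<in> \<P>. disk G val p Z P) \<and>
    (\<forall>P \<in> \<P>. \<forall>Q \<in> \<P>. P \<noteq> Q \<longrightarrow> set P \<inter> set Q = {})"

lemma disksD:
  assumes "disks G val p Z \<P>" "P \<in> \<P>"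
  shows "P \<noteq> []" "distinct P" "set P \<subseteq> Z" "cyc p P" "list_mult G (map val P) = \<one>\<^bsub>G\<^esub>"
  using assms by (simp_all add: disks_def disk_def)

lemma disks_disjoint:
  "disks G val p Z \<P> \<Longrightarrow> P \<in> \<P> \<Longrightarrow> Q \<in> \<P> \<Longrightarrow> x \<in> set P \<Longrightarrow> x \<in> set Q \<Longrightarrow> P = Q"
  unfolding disks_def by blast

text \<open>
  The points of \<open>Z\<close> are the letters on the boundary of a surface, and \<open>s\<close> passes to the next letter.
  The cycles of \<open>p\<close> are the polygons, \<open>\<P>\<close> consists of disks among them, and
  the cycles of \<open>p\<inverse> s\<close>, which the colours of \<open>h\<close> count, are the regions over the base point.
  There is one cutting arc for each letter, so the inequality says that \<open>\<chi>\<close> is at most the Euler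
  characteristic.
\<close>

definition filling :: "('g, 'c) monoid_scheme \<Rightarrow> ('d \<Rightarrow> 'g) \<Rightarrow> ('d \<Rightarrow> 'i) \<Rightarrow> 'd set \<Rightarrow> ('d \<Rightarrow> 'd) \<Rightarrow> int \<Rightarrow> bool" where
  "filling G val idx Z s \<chi> \<longleftrightarrow> (\<exists>p h \<P>. p permutes Z \<and> (\<forall>x \<in> Z. idx (p x) = idx x) \<and>
    compatible Z s p h \<and> disks G val p Z \<P> \<and>
    int (card Z) + \<chi> \<le> int (card \<P>) + int (card (h ` Z)))"

lemma disks_glue_subset:
  assumes "disks G val p Z \<P>" "\<P>' \<subseteq> \<P>" "\<And>P. P \<in> \<P>' \<Longrightarrow> d \<notin> set P \<and> d' \<notin> set P"
  shows "disks G val (glue d d' p) (Z - {d, d'}) \<P>'"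
  unfolding disks_def
proof (intro conjI ballI impI)
  show "finite \<P>'" using assms(1,2) unfolding disks_def by (auto intro: finite_subset)
next
  fix P assume P: "P \<in> \<P>'"
  then have "disk G val p Z P" using assms(1,2) unfolding disks_def by auto
  then show "disk G val (glue d d' p) (Z - {d, d'}) P"
    using assms(3)[OF P] by (auto simp: disk_def intro: cyc_glue_other)
next
  fix P Q assume "P \<in> \<P>'" "Q \<in> \<P>'" "P \<noteq> Q"
  then have "P \<in> \<P>" "Q \<in> \<P>" using assms(2) by auto
  then show "set P \<inter> set Q = {}" using assms(1) \<open>P \<noteq> Q\<close> by (simp add: disks_def)
qed

text \<open>The new polygon consists of sides of disks that are given up, so it is disjoint from the
  disks that are kept.\<close>

lemma disks_glue_insert:
  assumes "disks G val p Z \<P>" "\<P>' \<subseteq> \<P>" "\<And>P. P \<in> \<P>' \<Longrightarrow> d \<notin> set P \<and> d' \<notin> set P"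
    and "set A \<subseteq> (\<Union>P \<in> \<P> - \<P>'. set P) - {d, d'}" "A \<noteq> []" "distinct A"
    and "cyc (glue d d' p) A" "list_mult G (map val A) = \<one>\<^bsub>G\<^esub>"
  shows "disks G val (glue d d' p) (Z - {d, d'}) (insert A \<P>')" "A \<notin> \<P>'"
proof -
  have disj: "set A \<inter> set P = {}" if P: "P \<in> \<P>'" for P
  proof (rule equals0I)
    fix a assume a: "a \<in> set A \<inter> set P"
    then obtain Q where Q: "Q \<in> \<P> - \<P>'" "a \<in> set Q" using assms(4) by auto
    then have "P \<noteq> Q" "P \<in> \<P>" using P assms(2) by auto
    then have "set P \<inter> set Q = {}" using assms(1) Q(1) unfolding disks_def by simp
    then show False using Q(2) a by auto
  qed
  show "A \<notin> \<P>'"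
    using disj[of A] assms(5) by auto
  have "set A \<subseteq> Z - {d, d'}"
  proof
    fix a assume a: "a \<in> set A"
    then obtain Q where Q: "Q \<in> \<P>" "a \<in> set Q" "a \<noteq> d" "a \<noteq> d'" using assms(4) by auto
    then have "set Q \<subseteq> Z" using assms(1) unfolding disks_def disk_def by simp
    then show "a \<in> Z - {d, d'}" using Q by auto
  qed
  then have "disk G val (glue d d' p) (Z - {d, d'}) A"
    using assms(5-8) by (simp add: disk_def)
  moreover note disks_glue_subset[OF assms(1-3)]
  ultimately show "disks G val (glue d d' p) (Z - {d, d'}) (insert A \<P>')"
    using disj unfolding disks_def by (simp add: Int_commute)
qed

lemma (in group) disks_rotate:
  assumes "disks G val p Z \<P>" "val ` Z \<subseteq> carrier G" "P \<in> \<P>" "d \<in> set P"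
  obtains A where "set (d # A) = set P" "distinct (d # A)" "cyc p (d # A)"
    "list_mult G (map val (d # A)) = \<one>"
proof -
  obtain U V where P: "P = U @ d # V" using assms(4) by (meson split_list)
  have *: "distinct P" "set P \<subseteq> Z" "cyc p P" "list_mult G (map val P) = \<one>"
    using disksD[OF assms(1,3)] by auto
  have "set (map val U) \<subseteq> carrier G" "set (map val (d # V)) \<subseteq> carrier G"
    using * assms(2) unfolding P by auto
  from list_mult_rotate[OF this] have "list_mult G (map val (d # V @ U)) = \<one>"
    using * by (simp add: P)
  moreover have "cyc p (d # V @ U)" using cyc_rotate[of p U "d # V"] * by (simp add: P)
  ultimately show ?thesis using that[of "V @ U"] * by (auto simp: P)
qed

context group
begin

text \<open>Two different disks containing the two letters merge into one, since the rests of their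
  boundaries have inverse values. Otherwise at most one disk contains \<open>d\<close> or
  \<open>d'\<close>. It is given up, as nothing is known about the values of what the gluing makes
  of it.\<close>

lemma disks_glue:
  assumes \<P>: "disks G val p Z \<P>" and val: "val ` Z \<subseteq> carrier G"
    and d: "d \<in> Z" "d' \<in> Z" "d \<noteq> d'" "val d \<noteq> \<one>" "val d' = inv (val d)"
  obtains \<P>' where "disks G val (glue d d' p) (Z - {d, d'}) \<P>'" "card \<P> \<le> card \<P>' + 1"
proof (cases "\<exists>P \<in> \<P>. \<exists>Q \<in> \<P>. P \<noteq> Q \<and> d \<in> set P \<and> d' \<in> set Q")
  case True
  then obtain P Q where P: "P \<in> \<P>" "Q \<in> \<P>" "P \<noteq> Q" "d \<in> set P" "d' \<in> set Q" by blast
  obtain A where A: "set (d # A) = set P" "distinct (d # A)" "cyc p (d # A)"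
    "list_mult G (map val (d # A)) = \<one>"
    using disks_rotate[OF \<P> val P(1,4)] .
  obtain B where B: "set (d' # B) = set Q" "distinct (d' # B)" "cyc p (d' # B)"
    "list_mult G (map val (d' # B)) = \<one>"
    using disks_rotate[OF \<P> val P(2,5)] .
  have disj: "set (d # A) \<inter> set (d' # B) = {}"
    using disks_disjoint[OF \<P> P(1,2)] P(3) unfolding A(1) B(1) by blast
  have dist: "distinct (d # A @ d' # B)" using A(2) B(2) disj by auto
  have AZ: "set (d # A) \<subseteq> Z" "set (d' # B) \<subseteq> Z"
    using disksD(3)[OF \<P>] P(1,2) unfolding A(1) B(1) by blast+
  have c: "set (map val A) \<subseteq> carrier G" "set (map val B) \<subseteq> carrier G"
    "val d \<in> carrier G" using AZ val by auto
  have lA: "list_mult G (map val A) = inv (val d)"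
  proof -
    have "val d \<otimes> list_mult G (map val A) = \<one>" using A(4) by (simp add: list_mult_Cons)
    then have "inv (list_mult G (map val A)) = val d"
      using list_mult_closed[OF c(1)] c(3) by (rule inv_equality)
    then show ?thesis by (metis inv_inv[OF list_mult_closed[OF c(1)]])
  qed
  have lB: "list_mult G (map val B) = val d"
  proof -
    have "inv (val d) \<otimes> list_mult G (map val B) = \<one>"
      using B(4) d(5) by (simp add: list_mult_Cons)
    then have "inv (list_mult G (map val B)) = inv (val d)"
      using list_mult_closed[OF c(2)] inv_closed[OF c(3)] by (rule inv_equality)
    then show ?thesis by (metis inv_inv[OF list_mult_closed[OF c(2)]] inv_inv[OF c(3)])
  qed
  \<comment> \<open>A disk must have sides; this is where nontriviality of \<open>val d\<close>
    enters.\<close>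
  have ne: "A @ B \<noteq> []"
    using lA d(4) inv_eq_1_iff[OF c(3)] by (auto simp: list_mult_Nil)
  have prod: "list_mult G (map val (A @ B)) = \<one>"
    unfolding map_append list_mult_append[OF c(1,2)] lA lB using c(3) by simp
  have sub: "set (A @ B) \<subseteq> (\<Union>R \<in> \<P> - (\<P> - {P, Q}). set R) - {d, d'}"
  proof
    fix a assume a: "a \<in> set (A @ B)"
    then have "a \<in> set P \<or> a \<in> set Q" unfolding A(1)[symmetric] B(1)[symmetric] by auto
    moreover have "a \<noteq> d" "a \<noteq> d'" using a dist by auto
    ultimately show "a \<in> (\<Union>R \<in> \<P> - (\<P> - {P, Q}). set R) - {d, d'}" using P(1,2) by blast
  qed
  have other: "d \<notin> set R \<and> d' \<notin> set R" if "R \<in> \<P> - {P, Q}" for R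
    using that disks_disjoint[OF \<P>, of R P d] disks_disjoint[OF \<P>, of R Q d'] P by blast
  have "distinct (A @ B)" using dist by auto
  note new = disks_glue_insert[OF \<P> Diff_subset other sub ne this
      cyc_glue_join[OF A(3) B(3) dist] prod]
  have fin: "finite \<P>" using \<P> by (simp add: disks_def)
  have "card \<P> \<le> card (\<P> - {P, Q}) + 2"
    using P fin by (simp add: card_Diff_subset)
  then have "card \<P> \<le> card (insert (A @ B) (\<P> - {P, Q})) + 1"
    using new(2) fin by simp
  then show ?thesis using that new(1) by blast
next
  case False
  define \<P>' where "\<P>' = {P \<in> \<P>. d \<notin> set P \<and> d' \<notin> set P}"
  have fin: "finite \<P>" using \<P> by (simp add: disks_def)
  have "disks G val (glue d d' p) (Z - {d, d'}) \<P>'"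
    by (rule disks_glue_subset[OF \<P>]) (auto simp: \<P>'_def)
  moreover have "card \<P> \<le> card \<P>' + 1"
  proof -
    \<comment> \<open>Two disks given up would share one of the letters, against disjointness, or
      contain one letter each, which is the case settled above.\<close>
    have "P = Q" if "P \<in> \<P> - \<P>'" "Q \<in> \<P> - \<P>'" for P Q
    proof (rule ccontr)
      assume "P \<noteq> Q"
      have mem: "P \<in> \<P>" "Q \<in> \<P>" "d \<in> set P \<or> d' \<in> set P" "d \<in> set Q \<or> d' \<in> set Q"
        using that unfolding \<P>'_def by auto
      have "\<not> (d \<in> set P \<and> d \<in> set Q)" "\<not> (d' \<in> set P \<and> d' \<in> set Q)"
        using disks_disjoint[OF \<P> mem(1,2)] \<open>P \<noteq> Q\<close> by auto
      moreover have "\<not> (d \<in> set P \<and> d' \<in> set Q)" "\<not> (d \<in> set Q \<and> d' \<in> set P)"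
        using False mem(1,2) \<open>P \<noteq> Q\<close> by auto
      ultimately show False using mem(3,4) by argo
    qed
    then have "card (\<P> - \<P>') \<le> 1"
      using fin by (metis card_le_Suc0_iff_eq finite_Diff One_nat_def)
    moreover have "\<P>' \<subseteq> \<P>" by (auto simp: \<P>'_def)
    then have "card (\<P> - \<P>') = card \<P> - card \<P>'"
      using fin by (intro card_Diff_subset) (auto intro: finite_subset)
    ultimately show ?thesis by simp
  qed
  ultimately show ?thesis using that by blast
qed

text \<open>When \<open>d'\<close> follows \<open>d\<close> along a polygon, their values cancel in
  the product, so the rest of a disk is again a disk. The condition \<open>p d' \<noteq> d\<close>
  keeps this rest nonempty.\<close>

lemma disks_glue_adjacent:
  assumes \<P>: "disks G val p Z \<P>" and val: "val ` Z \<subseteq> carrier G"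
    and inj: "inj p"
    and d: "d \<in> Z" "d' \<in> Z" "d \<noteq> d'" "val d' = inv (val d)" "p d = d'" "p d' \<noteq> d"
  obtains \<P>' where "disks G val (glue d d' p) (Z - {d, d'}) \<P>'" "card \<P> \<le> card \<P>'"
proof (cases "\<exists>P \<in> \<P>. d \<in> set P \<or> d' \<in> set P")
  case True
  then obtain P where P: "P \<in> \<P>" "d \<in> set P \<or> d' \<in> set P" by blast
  have "d \<in> set P"
  proof -
    have "p ` set P = set P" using cyc_image disksD(4)[OF \<P> P(1)] .
    then show ?thesis using P(2) d(5) injD[OF inj] by (metis imageE)
  qed
  then obtain A where A: "set (d # A) = set P" "distinct (d # A)" "cyc p (d # A)"
    "list_mult G (map val (d # A)) = \<one>"
    using disks_rotate[OF \<P> val P(1)] by blast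
  obtain B where B: "A = d' # B"
    using A(3) d by (cases A) (auto simp: cyc_Cons)
  have "B \<noteq> []" using A(3) d B by (auto simp: cyc_Cons)
  have AZ: "set (d # A) \<subseteq> Z" using disksD(3)[OF \<P> P(1)] A(1) by simp
  have c: "set (map val B) \<subseteq> carrier G" "val d \<in> carrier G" using AZ val B by auto
  have prod: "list_mult G (map val B) = \<one>"
    using A(4) B d(4) c list_mult_closed[OF c(1)]
    by (simp add: list_mult_Cons m_assoc[symmetric])
  have "cyc p (d # [] @ d' # B)" "distinct (d # [] @ d' # B)" using A(2,3) B by simp_all
  note cut = cyc_glue_cut(2)[OF this]
  have sub: "set B \<subseteq> (\<Union>R \<in> \<P> - (\<P> - {P}). set R) - {d, d'}"
  proof
    fix a assume a: "a \<in> set B"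
    then have "a \<in> set P" unfolding A(1)[symmetric] B by auto
    moreover have "a \<noteq> d" "a \<noteq> d'" using a A(2) B by auto
    ultimately show "a \<in> (\<Union>R \<in> \<P> - (\<P> - {P}). set R) - {d, d'}" using P(1) by blast
  qed
  have other: "d \<notin> set R \<and> d' \<notin> set R" if "R \<in> \<P> - {P}" for R
  proof -
    have "d \<in> set P" "d' \<in> set P" unfolding A(1)[symmetric] B by auto
    then show ?thesis
      using that P(1) disks_disjoint[OF \<P>, of R P d] disks_disjoint[OF \<P>, of R P d'] by blast
  qed
  have "distinct B" using A(2) B by simp
  note new = disks_glue_insert[OF \<P> Diff_subset other sub \<open>B \<noteq> []\<close> this cut prod]
  have fin: "finite \<P>" using \<P> by (simp add: disks_def)
  then have "card \<P> \<le> card (insert B (\<P> - {P}))"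
    using P new(2) by (metis card_insert_disjoint card_Suc_Diff1 finite_Diff le_refl)
  then show ?thesis using that new(1) by blast
next
  case False
  then show ?thesis using that disks_glue_subset[OF \<P> order_refl, of d d'] by blast
qed

text \<open>Gluing removes two letters, at most one disk and, by two deletions, at most two colours,
  whence the loss of 1 in \<chi>. Letters that are adjacent on the boundary already share an
  endpoint, and then one of these losses is avoided.\<close>

lemma filling_glue:
  assumes f: "filling G val idx Z s \<chi>" and Z: "finite Z" and s: "s permutes Z"
    and val: "val ` Z \<subseteq> carrier G"
    and d: "d \<in> Z" "d' \<in> Z" "d \<noteq> d'" "val d \<noteq> \<one>" "val d' = inv (val d)" "idx d' = idx d"
  shows "filling G val idx (Z - {d, d'}) (glue d d' s) (\<chi> - 1)"
    and "s d = d' \<Longrightarrow> s d' \<noteq> d \<Longrightarrow> filling G val idx (Z - {d, d'}) (glue d d' s) \<chi>"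
proof -
  obtain p h \<P> where p: "p permutes Z" "\<And>x. x \<in> Z \<Longrightarrow> idx (p x) = idx x"
    and h: "compatible Z s p h" and \<P>: "disks G val p Z \<P>"
    and card: "int (card Z) + \<chi> \<le> int (card \<P>) + int (card (h ` Z))"
    using f unfolding filling_def by blast
  define s1 p1 where "s1 = transpose d d' \<circ> s" and "p1 = transpose d d' \<circ> p"
  have perm1: "s1 permutes Z" "p1 permutes Z"
    unfolding s1_def p1_def using s p d by (auto intro!: permutes_compose permutes_swap_id)
  \<comment> \<open>Composing both permutations with the same transposition does not change the
    inverse of \<open>p\<close> after \<open>s\<close>.\<close>
  have h1: "compatible Z s1 p1 h"
    using h unfolding compatible_def s1_def p1_def
    by (auto simp: transpose_eq_iff)
  obtain h2 where h2: "compatible (Z - {d}) (del d s1) (del d p1) h2"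
    "card (h ` Z) \<le> card (h2 ` (Z - {d})) + 1"
    "(s1 d = d) \<noteq> (p1 d = d) \<longrightarrow> card (h ` Z) \<le> card (h2 ` (Z - {d}))"
    using compatible_del[OF perm1 d(1) Z h1] .
  have perm2: "del d s1 permutes Z - {d}" "del d p1 permutes Z - {d}"
    using perm1 d by (auto intro!: del_permutes)
  obtain h3 where h3: "compatible (Z - {d} - {d'}) (del d' (del d s1)) (del d' (del d p1)) h3"
    "card (h2 ` (Z - {d})) \<le> card (h3 ` (Z - {d} - {d'})) + 1"
    "(del d s1 d' = d') \<noteq> (del d p1 d' = d') \<longrightarrow> card (h2 ` (Z - {d})) \<le> card (h3 ` (Z - {d} - {d'}))"
  proof -
    have "d' \<in> Z - {d}" "finite (Z - {d})" using d Z by auto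
    from compatible_del[OF perm2 this h2(1)] that show ?thesis .
  qed
  have eq: "Z - {d} - {d'} = Z - {d, d'}" by auto
  have h4: "compatible (Z - {d, d'}) (glue d d' s) (glue d d' p) h3"
    using h3(1) unfolding glue_def s1_def p1_def eq by simp
  have pZ: "glue d d' p permutes Z - {d, d'}"
    using p d by (intro glue_permutes)
  have p_idx: "idx (glue d d' p x) = idx x" if "x \<in> Z - {d, d'}" for x
  proof -
    have t: "idx (transpose d d' y) = idx y" for y using d(6) by (simp add: transpose_def)
    have 1: "idx (p1 y) = idx y" if "y \<in> Z" for y using that p by (simp add: p1_def t)
    have 2: "idx (del d p1 y) = idx y" if "y \<in> Z" for y
      using that 1[of y] 1[OF d(1)] by (auto simp: del_def)
    show ?thesis
      using that 2[of x] 2[OF d(2)] unfolding glue_def p1_def[symmetric] by (auto simp: del_def[of d'])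
  qed
  have "card {d, d'} \<le> card Z" using Z d by (intro card_mono) auto
  then have cZ: "card Z = card (Z - {d, d'}) + 2"
    using d by (simp add: card_Diff_subset)
  have fillI: "filling G val idx (Z - {d, d'}) (glue d d' s) c"
    if "disks G val (glue d d' p) (Z - {d, d'}) \<P>'"
      "int (card Z) + c \<le> int (card \<P>') + int (card (h3 ` (Z - {d, d'}))) + 2" for c \<P>'
    unfolding filling_def using pZ p_idx h4 that cZ
    by (intro exI[of _ "glue d d' p"] exI[of _ h3] exI[of _ \<P>']) auto
  obtain \<P>' where \<P>': "disks G val (glue d d' p) (Z - {d, d'}) \<P>'" "card \<P> \<le> card \<P>' + 1"
    using disks_glue[OF \<P> val d(1-5)] .
  show "filling G val idx (Z - {d, d'}) (glue d d' s) (\<chi> - 1)"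
    by (rule fillI[OF \<P>'(1)]) (use \<P>'(2) h2(2) h3(2) card in \<open>simp add: eq\<close>)
  assume sd: "s d = d'" "s d' \<noteq> d"
  have s1d: "s1 d = d" using sd by (simp add: s1_def)
  have ij: "s x = s y \<longleftrightarrow> x = y" "p x = p y \<longleftrightarrow> x = y" for x y
    using permutes_inj[OF s] permutes_inj[OF p(1)] by (auto simp: inj_eq)
  show "filling G val idx (Z - {d, d'}) (glue d d' s) \<chi>"
  \<comment> \<open>If \<open>p d \<noteq> d'\<close>, deleting \<open>d\<close> costs no colour,
    since \<open>s1\<close> fixes \<open>d\<close> and \<open>p1\<close> does not. If
    \<open>p\<close> exchanges \<open>d\<close> and \<open>d'\<close>, deleting \<open>d'\<close>
    costs no colour. In the remaining case no disk is lost.\<close>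
  proof (cases "p d = d'")
    case False
    then have "p1 d \<noteq> d" by (auto simp: p1_def transpose_def)
    then show ?thesis
      using fillI[OF \<P>'(1)] \<P>'(2) h2(3) s1d h3(2) card by (simp add: eq)
  next
    case True
    show ?thesis
    proof (cases "p d' = d")
      case True
      have "p1 d = d" "p1 d' = d'" using True \<open>p d = d'\<close> by (auto simp: p1_def)
      then have 1: "del d p1 d' = d'" using d by (auto simp: del_def)
      have "s1 d' \<noteq> d'" "s1 d' \<noteq> d"
        using sd d ij by (auto simp: s1_def transpose_def)
      then have "del d s1 d' \<noteq> d'" using d by (auto simp: del_def)
      then show ?thesis
        using fillI[OF \<P>'(1)] \<P>'(2) h2(2) 1 h3(3) card by (simp add: eq)
    next
      case F: False
      obtain \<P>'' where "disks G val (glue d d' p) (Z - {d, d'}) \<P>''" "card \<P> \<le> card \<P>''"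
        using disks_glue_adjacent[OF \<P> val permutes_inj[OF p(1)] d(1-3,5) True F] .
      then show ?thesis
        using fillI[of \<P>''] h2(2) h3(2) card by (simp add: eq)
    qed
  qed
qed

end

section \<open>Cyclic words bounding a surface\<close>

text \<open>As \<open>d\<close> is fixed by \<open>f\<close>, precomposition with the transposition
  sends \<open>e\<close> to \<open>d\<close> and \<open>d\<close> to the old successor of
  \<open>e\<close>.\<close>

lemma cyc_insert:
  assumes "cyc f (e # T)" "f d = d" "d \<notin> set (e # T)" "distinct (e # T)"
  shows "cyc (f \<circ> transpose e d) (e # d # T)"
proof -
  have m: "map (f \<circ> transpose e d) T = map f T"
    using assms(3,4) by (auto simp: transpose_def)
  have "f e # map f T = T @ [e]" using assms(1) by (simp add: cyc_Cons)
  then show ?thesis using assms(2) by (simp add: cyc_Cons m)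
qed

lemma cyc_insert_other:
  assumes "cyc f w" "d \<notin> set w" "d' \<notin> set w"
  shows "cyc (f \<circ> transpose d d') w"
proof -
  have "map (f \<circ> transpose d d') w = map f w"
    using assms by (auto simp: transpose_def)
  then show ?thesis using assms(1) by (metis cyc_def)
qed

lemma permutes_insert_transpose:
  assumes "f permutes Z" "e \<in> Z"
  shows "f \<circ> transpose e d permutes insert d Z"
proof -
  have "f permutes insert d Z" using assms(1) by (rule permutes_subset) auto
  then show ?thesis using assms(2) by (intro permutes_compose permutes_swap_id) auto
qed

text \<open>The words label the boundary curves. The underlying points are natural numbers, so that
  equal letters at different places are kept apart and a fresh point is always at hand.\<close>

definition bounds_surface :: "('g, 'c) monoid_scheme \<Rightarrow> ('l \<Rightarrow> 'g) \<Rightarrow> ('l \<Rightarrow> 'i) \<Rightarrow> int \<Rightarrow> 'l list list \<Rightarrow> bool" where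
  "bounds_surface G val idx \<chi> ws \<longleftrightarrow> (\<exists>(lab :: nat \<Rightarrow> 'l) ts s. map (map lab) ts = ws \<and> distinct (concat ts) \<and>
    s permutes set (concat ts) \<and> (\<forall>t \<in> set ts. cyc s t) \<and>
    filling G (val \<circ> lab) (idx \<circ> lab) (set (concat ts)) s \<chi>)"

lemma bounds_surfaceE:
  assumes "bounds_surface G val idx \<chi> ws"
  obtains lab :: "nat \<Rightarrow> 'l" and ts s where "map (map lab) ts = ws" "distinct (concat ts)"
    "s permutes set (concat ts)" "\<forall>t \<in> set ts. cyc s t"
    "filling G (val \<circ> lab) (idx \<circ> lab) (set (concat ts)) s \<chi>"
  using assms unfolding bounds_surface_def by (elim exE conjE)

lemma bounds_surface_rotate:
  assumes "bounds_surface G val idx \<chi> ((u @ v) # ws)"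
  shows "bounds_surface G val idx \<chi> ((v @ u) # ws)"
proof -
  obtain lab :: "nat \<Rightarrow> _" and ts s where ts: "map (map lab) ts = (u @ v) # ws" "distinct (concat ts)"
    "s permutes set (concat ts)" "\<forall>t \<in> set ts. cyc s t"
    "filling G (val \<circ> lab) (idx \<circ> lab) (set (concat ts)) s \<chi>"
    using bounds_surfaceE[OF assms] by metis
  obtain t ts' where t: "ts = t # ts'" "map lab t = u @ v" "map (map lab) ts' = ws"
    using ts(1) by (auto simp: Cons_eq_map_conv)
  obtain a b where ab: "t = a @ b" "map lab a = u" "map lab b = v"
    using t(2) by (auto simp: map_eq_append_conv)
  have "set (concat ((b @ a) # ts')) = set (concat ts)" by (auto simp: t(1) ab(1))
  then show ?thesis
    unfolding bounds_surface_def using ts t ab cyc_rotate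
    by (intro exI[of _ lab] exI[of _ "(b @ a) # ts'"] exI[of _ s]) auto
qed

context group
begin

definition inverse_letters :: "('l \<Rightarrow> 'a) \<Rightarrow> ('l \<Rightarrow> 'i) \<Rightarrow> 'l \<Rightarrow> 'l \<Rightarrow> bool" where
  "inverse_letters val idx a b \<longleftrightarrow>
    val a \<in> carrier G \<and> val a \<noteq> \<one> \<and> val b = inv (val a) \<and> idx b = idx a"

lemma bounds_surface_remove:
  fixes lab :: "nat \<Rightarrow> 'l"
  assumes "filling G (val \<circ> lab) (idx \<circ> lab) (set (concat ts)) s \<chi>"
    and "s permutes set (concat ts)" "\<forall>t \<in> set ts. val ` lab ` set t \<subseteq> carrier G"
    and d: "d \<in> set (concat ts)" "d' \<in> set (concat ts)" "d \<noteq> d'"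
    and inv: "inverse_letters val idx (lab d) (lab d')"
    and ts': "set (concat ts') = set (concat ts) - {d, d'}" "distinct (concat ts')"
      "\<forall>t \<in> set ts'. cyc (glue d d' s) t"
  shows "bounds_surface G val idx (\<chi> - 1) (map (map lab) ts')"
    and "s d = d' \<Longrightarrow> s d' \<noteq> d \<Longrightarrow> bounds_surface G val idx \<chi> (map (map lab) ts')"
proof -
  have "(val \<circ> lab) ` set (concat ts) \<subseteq> carrier G" using assms(3) by auto
  moreover have "(val \<circ> lab) d \<noteq> \<one>" "(val \<circ> lab) d' = inv ((val \<circ> lab) d)" "(idx \<circ> lab) d' = (idx \<circ> lab) d"
    using inv by (simp_all add: inverse_letters_def)
  ultimately have fill: "filling G (val \<circ> lab) (idx \<circ> lab) (set (concat ts')) (glue d d' s) (\<chi> - 1)"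
    "s d = d' \<Longrightarrow> s d' \<noteq> d \<Longrightarrow> filling G (val \<circ> lab) (idx \<circ> lab) (set (concat ts')) (glue d d' s) \<chi>"
    unfolding ts'(1) using filling_glue[OF assms(1) finite_set assms(2) _ d] by simp_all
  have perm: "glue d d' s permutes set (concat ts')"
    unfolding ts'(1) using assms(2) d by (rule glue_permutes)
  show "bounds_surface G val idx (\<chi> - 1) (map (map lab) ts')"
    unfolding bounds_surface_def using fill(1) perm ts'(2,3) by blast
  show "bounds_surface G val idx \<chi> (map (map lab) ts')" if "s d = d'" "s d' \<noteq> d"
    unfolding bounds_surface_def using fill(2)[OF that] perm ts'(2,3) by blast
qed

text \<open>The second part folds two adjacent letters onto each other, which preserves \<chi>. That
  \<open>B\<close> is nonempty provides the condition \<open>s d' \<noteq> d\<close> of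
  \<open>filling_glue\<close>.\<close>

lemma bounds_surface_cut:
  assumes sp: "bounds_surface G val idx \<chi> ((a # A @ b # B) # ws)"
    and car: "\<forall>w \<in> set ((a # A @ b # B) # ws). val ` set w \<subseteq> carrier G"
    and inv: "inverse_letters val idx a b"
  shows "bounds_surface G val idx (\<chi> - 1) (A # B # ws)"
    and "A = [] \<Longrightarrow> B \<noteq> [] \<Longrightarrow> bounds_surface G val idx \<chi> (B # ws)"
proof -
  obtain lab :: "nat \<Rightarrow> _" and ts s where ts: "map (map lab) ts = (a # A @ b # B) # ws" "distinct (concat ts)"
    "s permutes set (concat ts)" "\<forall>t \<in> set ts. cyc s t"
    "filling G (val \<circ> lab) (idx \<circ> lab) (set (concat ts)) s \<chi>"
    using bounds_surfaceE[OF sp] by metis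
  obtain d A' d' B' ts' where t: "ts = (d # A' @ d' # B') # ts'" "lab d = a" "map lab A' = A"
      "lab d' = b" "map lab B' = B" "map (map lab) ts' = ws"
    using ts(1) by (auto simp: Cons_eq_map_conv map_eq_append_conv append_eq_map_conv)
  have car': "\<forall>t \<in> set ts. val ` lab ` set t \<subseteq> carrier G"
  proof
    fix t assume "t \<in> set ts"
    then have "map lab t \<in> set ((a # A @ b # B) # ws)" unfolding ts(1)[symmetric] by simp
    then show "val ` lab ` set t \<subseteq> carrier G" using car by (metis list.set_map)
  qed
  have d: "d \<in> set (concat ts)" "d' \<in> set (concat ts)" "d \<noteq> d'" using ts(2) by (auto simp: t(1))
  have inv': "inverse_letters val idx (lab d) (lab d')" using inv t by simp
  have c: "cyc s (d # A' @ d' # B')" "distinct (d # A' @ d' # B')" using ts(2,4) by (auto simp: t(1))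
  have set_eq: "set (concat (A' # B' # ts')) = set (concat ts) - {d, d'}" "distinct (concat (A' # B' # ts'))"
    using ts(2) by (auto simp: t(1))
  have other: "cyc (glue d d' s) t" if "t \<in> set ts'" for t
    using that ts(2,4) by (intro cyc_glue_other) (auto simp: t(1))
  have cycs: "\<forall>t \<in> set (A' # B' # ts'). cyc (glue d d' s) t"
    using other cyc_glue_cut[OF c] by auto
  show "bounds_surface G val idx (\<chi> - 1) (A # B # ws)"
    using bounds_surface_remove(1)[OF ts(5,3) car' d inv' set_eq cycs] by (simp add: t)
  assume AB: "A = []" "B \<noteq> []"
  then have A': "A' = []" "B' \<noteq> []" using t by auto
  have cc: "concat (A' # B' # ts') = concat (B' # ts')" using A'(1) by simp
  obtain e B'' where B': "B' = e # B''" using A'(2) by (cases B') auto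
  have "map s (d # d' # e # B'') = d' # e # B'' @ [d]" using c(1) unfolding A' B' cyc_Cons by simp
  then have "s d = d'" "s d' = e" by simp_all
  moreover have "e \<noteq> d" using c(2) B' by auto
  ultimately have sd: "s d = d'" "s d' \<noteq> d" by simp_all
  have "map (map lab) (B' # ts') = B # ws" using t by simp
  moreover have "\<forall>t \<in> set (B' # ts'). cyc (glue d d' s) t" using cycs by simp
  ultimately show "bounds_surface G val idx \<chi> (B # ws)"
    using bounds_surface_remove(2)[OF ts(5,3) car' d inv' set_eq[unfolded cc] _ sd] by metis
qed

lemma bounds_surface_join:
  assumes sp: "bounds_surface G val idx \<chi> ((a # A) # (b # B) # ws)"
    and car: "\<forall>w \<in> set ((a # A) # (b # B) # ws). val ` set w \<subseteq> carrier G"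
    and inv: "inverse_letters val idx a b"
  shows "bounds_surface G val idx (\<chi> - 1) ((A @ B) # ws)"
proof -
  obtain lab :: "nat \<Rightarrow> _" and ts s where ts: "map (map lab) ts = (a # A) # (b # B) # ws" "distinct (concat ts)"
    "s permutes set (concat ts)" "\<forall>t \<in> set ts. cyc s t"
    "filling G (val \<circ> lab) (idx \<circ> lab) (set (concat ts)) s \<chi>"
    using bounds_surfaceE[OF sp] by metis
  obtain d A' d' B' ts' where t: "ts = (d # A') # (d' # B') # ts'" "lab d = a" "map lab A' = A"
      "lab d' = b" "map lab B' = B" "map (map lab) ts' = ws"
    using ts(1) by (auto simp: Cons_eq_map_conv)
  have car': "\<forall>t \<in> set ts. val ` lab ` set t \<subseteq> carrier G"
  proof
    fix t assume "t \<in> set ts"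
    then have "map lab t \<in> set ((a # A) # (b # B) # ws)" unfolding ts(1)[symmetric] by simp
    then show "val ` lab ` set t \<subseteq> carrier G" using car by (metis list.set_map)
  qed
  have d: "d \<in> set (concat ts)" "d' \<in> set (concat ts)" "d \<noteq> d'" using ts(2) by (auto simp: t(1))
  have inv': "inverse_letters val idx (lab d) (lab d')" using inv t by simp
  have c: "cyc s (d # A')" "cyc s (d' # B')" "distinct (d # A' @ d' # B')"
    using ts(2,4) by (auto simp: t(1))
  have set_eq: "set (concat ((A' @ B') # ts')) = set (concat ts) - {d, d'}" "distinct (concat ((A' @ B') # ts'))"
    using ts(2) by (auto simp: t(1))
  have other: "cyc (glue d d' s) t" if "t \<in> set ts'" for t
    using that ts(2,4) by (intro cyc_glue_other) (auto simp: t(1))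
  have cycs: "\<forall>t \<in> set ((A' @ B') # ts'). cyc (glue d d' s) t"
    using other cyc_glue_join[OF c] by auto
  show ?thesis
    using bounds_surface_remove(1)[OF ts(5,3) car' d inv' set_eq cycs] by (simp add: t)
qed

section \<open>Building a surface up letter by letter\<close>

lemma bounds_surface_single:
  assumes "val a = \<one>"
  shows "bounds_surface G val idx 1 [[a]]"
proof -
  \<comment> \<open>This is a monogon: one letter, one disk and one colour, so the inequality reads
    \<open>1 + 1 \<le> 1 + 1\<close>.\<close>
  have "filling G (val \<circ> (\<lambda>_. a)) (idx \<circ> (\<lambda>_. a)) {0 :: nat} id 1"
    unfolding filling_def using assms
    by (intro exI[of _ id] exI[of _ "\<lambda>_. 0"] exI[of _ "{[0]}"])
      (auto simp: permutes_id compatible_def disks_def disk_def cyc_def list_mult_Cons list_mult_Nil)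
  then show ?thesis
    unfolding bounds_surface_def
    by (intro exI[of _ "\<lambda>_. a"] exI[of _ "[[0]]"] exI[of _ id]) (simp add: permutes_id cyc_def)
qed

text \<open>The new letter bounds a disk of its own and takes the colour of the letter before it.
  Letters and disks increase by one, and the number of colours stays the same.\<close>

lemma bounds_surface_insert_one:
  assumes sp: "bounds_surface G val idx \<chi> [x # v]" and a: "val a = \<one>"
  shows "bounds_surface G val idx \<chi> [x # a # v]"
proof -
  obtain lab :: "nat \<Rightarrow> _" and ts s where ts: "map (map lab) ts = [x # v]" "distinct (concat ts)"
    "s permutes set (concat ts)" "\<forall>t \<in> set ts. cyc s t"
    "filling G (val \<circ> lab) (idx \<circ> lab) (set (concat ts)) s \<chi>"
    using bounds_surfaceE[OF sp] by metis
  obtain e T where t: "ts = [e # T]" "lab e = x" "map lab T = v"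
    using ts(1) by (auto simp: Cons_eq_map_conv)
  define Z where "Z = set (e # T)"
  have Z: "set (concat ts) = Z" "finite Z" "e \<in> Z" by (simp_all add: t Z_def)
  obtain p h \<P> where p: "p permutes Z" "\<forall>x \<in> Z. (idx \<circ> lab) (p x) = (idx \<circ> lab) x"
    and h: "compatible Z s p h" and \<P>: "disks G (val \<circ> lab) p Z \<P>"
    and card: "int (card Z) + \<chi> \<le> int (card \<P>) + int (card (h ` Z))"
    using ts(5) unfolding filling_def Z by blast
  obtain d where d: "d \<notin> Z" using Z(2) ex_new_if_finite[OF infinite_UNIV_nat] by blast
  define lab' where "lab' = lab(d := a)"
  define s' where "s' = s \<circ> transpose e d"
  define h' where "h' = h(d := h e)"
  have sZ: "s permutes Z" using ts(3) Z by simp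
  have sd: "s d = d" "p d = d" using sZ p d by (auto simp: permutes_not_in)
  have neq: "d \<noteq> e" using d Z by auto
  have lab': "lab' y = lab y" if "y \<in> Z" for y using that d by (auto simp: lab'_def)
  have fin: "finite \<P>" using \<P> by (simp add: disks_def)
  have "compatible (insert d Z) s' p h'"
    unfolding compatible_def
  proof (intro ballI impI)
    fix y z assume yz: "y \<in> insert d Z" "z \<in> insert d Z" and e: "p y = s' z"
    consider "z = e" | "z = d" | "z \<in> Z" "z \<noteq> e" "z \<noteq> d" using yz by blast
    then show "h' y = h' z"
    proof cases
      case 1
      then have "p y = d" using e sd by (simp add: s'_def)
      then have "y = d" using sd permutes_inj[OF p(1)] by (metis injD)
      then show ?thesis using 1 by (simp add: h'_def)
    next
      case 2
      then have py: "p y = s e" using e by (simp add: s'_def)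
      then have "p y \<in> Z" using Z(3) permutes_in_image[OF sZ, of e] by simp
      then have "y \<in> Z" using permutes_in_image[OF p(1)] by blast
      then show ?thesis using h py Z(3) 2 d unfolding compatible_def by (auto simp: h'_def)
    next
      case 3
      then have py: "p y = s z" using e by (simp add: s'_def)
      then have "p y \<in> Z" using 3 permutes_in_image[OF sZ, of z] by simp
      then have "y \<in> Z" using permutes_in_image[OF p(1)] by blast
      then have "y \<noteq> d" "h y = h z" using h py 3 d unfolding compatible_def by auto
      then show ?thesis using 3 by (simp add: h'_def)
    qed
  qed
  moreover have "p permutes insert d Z" using p(1) by (rule permutes_subset) auto
  moreover have "\<forall>x \<in> insert d Z. (idx \<circ> lab') (p x) = (idx \<circ> lab') x"
    using p(2) sd permutes_in_image[OF p(1)] by (auto simp: lab')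
  moreover have "disks G (val \<circ> lab') p (insert d Z) (insert [d] \<P>)"
  proof -
    have "disk G (val \<circ> lab') p (insert d Z) P" if "P \<in> \<P>" for P
    proof -
      have "map (val \<circ> lab') P = map (val \<circ> lab) P"
        using disksD(3)[OF \<P> that] lab' by auto
      then have "list_mult G (map (val \<circ> lab') P) = \<one>" using disksD(5)[OF \<P> that] by argo
      then show ?thesis using disksD(1-4)[OF \<P> that] unfolding disk_def by auto
    qed
    moreover have "disk G (val \<circ> lab') p (insert d Z) [d]"
      using a sd by (simp add: disk_def cyc_def lab'_def list_mult_Cons list_mult_Nil)
    moreover have "d \<notin> set P" if "P \<in> \<P>" for P using disksD(3)[OF \<P> that] d by auto
    ultimately show ?thesis using \<P> unfolding disks_def by simp
  qed
  moreover have "card (insert [d] \<P>) = card \<P> + 1"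
  proof -
    have "[d] \<notin> \<P>" using disksD(3)[OF \<P>, of "[d]"] d by auto
    then show ?thesis using fin by simp
  qed
  moreover have "h' ` insert d Z = h ` Z"
    using Z(3) d by (auto simp: h'_def)
  moreover have "card (insert d Z) = card Z + 1" using Z d by simp
  ultimately have "filling G (val \<circ> lab') (idx \<circ> lab') (insert d Z) s' \<chi>"
    unfolding filling_def using card
    by (intro exI[of _ p] exI[of _ h'] exI[of _ "insert [d] \<P>"]) simp
  moreover have "set (concat [e # d # T]) = insert d Z" by (auto simp: Z_def)
  moreover have "s' permutes insert d Z"
    unfolding s'_def using sZ Z(3) by (rule permutes_insert_transpose)
  moreover have "cyc s' (e # d # T)"
    unfolding s'_def using ts(2,4) d sd by (intro cyc_insert) (auto simp: t Z_def)
  moreover have "map (map lab') [e # d # T] = [x # a # v]"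
  proof -
    have "map lab' T = map lab T" using lab' by (auto simp: Z_def)
    then show ?thesis using lab'[OF Z(3)] t by (simp add: lab'_def)
  qed
  moreover have "distinct (concat [e # d # T])" using ts(2) d by (auto simp: t Z_def)
  ultimately show ?thesis
    unfolding bounds_surface_def
    by (intro exI[of _ lab'] exI[of _ "[e # d # T]"] exI[of _ s']) simp
qed

text \<open>The point labelled \<open>c\<close> is relabelled \<open>a\<close>, and a new point
  labelled \<open>b\<close> is put after it both along the boundary and along its polygon. The old
  point then forms a region by itself, and its new colour pays for the additional letter.\<close>

lemma bounds_surface_split:
  assumes sp: "bounds_surface G val idx \<chi> [c # v]"
    and car: "val ` set (c # v) \<subseteq> carrier G" "val a \<in> carrier G" "val b \<in> carrier G"
    and ab: "val c = val a \<otimes> val b" "idx a = idx c" "idx b = idx c"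
  shows "bounds_surface G val idx \<chi> [a # b # v]"
proof -
  obtain lab :: "nat \<Rightarrow> _" and ts s where ts: "map (map lab) ts = [c # v]" "distinct (concat ts)"
    "s permutes set (concat ts)" "\<forall>t \<in> set ts. cyc s t"
    "filling G (val \<circ> lab) (idx \<circ> lab) (set (concat ts)) s \<chi>"
    using bounds_surfaceE[OF sp] by metis
  obtain e T where t: "ts = [e # T]" "lab e = c" "map lab T = v"
    using ts(1) by (auto simp: Cons_eq_map_conv)
  define Z where "Z = set (e # T)"
  have Z: "set (concat ts) = Z" "finite Z" "e \<in> Z" by (simp_all add: t Z_def)
  obtain p h \<P> where p: "p permutes Z" "\<forall>x \<in> Z. (idx \<circ> lab) (p x) = (idx \<circ> lab) x"
    and h: "compatible Z s p h" and \<P>: "disks G (val \<circ> lab) p Z \<P>"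
    and card: "int (card Z) + \<chi> \<le> int (card \<P>) + int (card (h ` Z))"
    using ts(5) unfolding filling_def Z by blast
  obtain d where d: "d \<notin> Z" using Z(2) ex_new_if_finite[OF infinite_UNIV_nat] by blast
  obtain k where k: "k \<notin> h ` Z" using Z(2) ex_new_if_finite[OF infinite_UNIV_nat] by (metis finite_imageI)
  define lab' where "lab' = lab(e := a, d := b)"
  define s' p' where "s' = s \<circ> transpose e d" and "p' = p \<circ> transpose e d"
  define h' where "h' = h(d := h e, e := k)"
  have sZ: "s permutes Z" using ts(3) Z by simp
  have sd: "s d = d" "p d = d" using sZ p d by (auto simp: permutes_not_in)
  have neq: "d \<noteq> e" using d Z by auto
  have inj: "inj s" "inj p" using permutes_inj sZ p(1) by blast+
  have lab': "lab' y = lab y" if "y \<in> Z" "y \<noteq> e" for y using that d by (auto simp: lab'_def)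
  have lab'': "lab' e = a" "lab' d = b" using neq by (auto simp: lab'_def)
  have s': "s' e = d" "p' e = d" "s' d = s e" "p' d = p e" using sd by (simp_all add: s'_def p'_def)
  have s'o: "s' y = s y" "p' y = p y" if "y \<noteq> e" "y \<noteq> d" for y using that by (simp_all add: s'_def p'_def)
  have fin: "finite \<P>" using \<P> by (simp add: disks_def)
  have perm: "s' permutes insert d Z" "p' permutes insert d Z"
    unfolding s'_def p'_def using sZ p(1) Z(3) by (auto intro: permutes_insert_transpose)
  have "compatible (insert d Z) s' p' h'"
    unfolding compatible_def
  proof (intro ballI impI)
    fix y z assume yz: "y \<in> insert d Z" "z \<in> insert d Z" and eq: "p' y = s' z"
    show "h' y = h' z"
    \<comment> \<open>Both \<open>s'\<close> and \<open>p'\<close> send \<open>e\<close> to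
      \<open>d\<close>, so \<open>e\<close> is matched only with itself and may carry the new colour
      \<open>k\<close> alone.\<close>
    proof (cases "y = e \<or> z = e")
      case True
      then have "y = e \<and> z = e"
        using eq s' permutes_inj[OF perm(1)] permutes_inj[OF perm(2)] by (metis injD)
      then show ?thesis by simp
    next
      case False
      \<comment> \<open>Away from \<open>e\<close>, the point \<open>d\<close> has taken over the
        part that \<open>e\<close> played before the split.\<close>
      define y0 z0 where "y0 = (if y = d then e else y)" and "z0 = (if z = d then e else z)"
      have "p y0 = s z0" using eq False s' s'o[of y] s'o[of z] by (auto simp: y0_def z0_def)
      moreover have "y0 \<in> Z" "z0 \<in> Z" using yz Z(3) by (auto simp: y0_def z0_def)
      ultimately have "h y0 = h z0" using h unfolding compatible_def by blast
      moreover have "h' y = h y0" "h' z = h z0" using False neq by (auto simp: h'_def y0_def z0_def)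
      ultimately show ?thesis by simp
    qed
  qed
  moreover have "\<forall>x \<in> insert d Z. (idx \<circ> lab') (p' x) = (idx \<circ> lab') x"
  proof
    fix x assume x: "x \<in> insert d Z"
    have idx': "idx (lab' y) = idx (lab y)" if "y \<in> Z" for y
      using that lab'[of y] lab'' ab t by (cases "y = e") auto
    have pZ: "p y \<in> Z" if "y \<in> Z" for y using permutes_in_image[OF p(1)] that by blast
    consider "x = e" | "x = d" | "x \<in> Z" "x \<noteq> e" "x \<noteq> d" using x by blast
    then show "(idx \<circ> lab') (p' x) = (idx \<circ> lab') x"
    proof cases
      case 1
      then show ?thesis using s' lab'' ab by simp
    next
      case 2
      then show ?thesis using s' lab'' ab idx'[OF pZ[OF Z(3)]] p(2) Z(3) t(2) by simp
    next
      case 3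
      then show ?thesis using s'o idx'[OF pZ[OF 3(1)]] idx'[OF 3(1)] p(2) by simp
    qed
  qed
  moreover obtain \<P>' where "disks G (val \<circ> lab') p' (insert d Z) \<P>'" "card \<P>' = card \<P>"
  proof (cases "\<exists>P \<in> \<P>. e \<in> set P")
    case False
    have "disk G (val \<circ> lab') p' (insert d Z) P" if "P \<in> \<P>" for P
    proof -
      have PZ: "set P \<subseteq> Z" "e \<notin> set P" using disksD(3)[OF \<P> that] False that by auto
      have "lab' x = lab x" if "x \<in> set P" for x using PZ that by (intro lab') auto
      then have "map (val \<circ> lab') P = map (val \<circ> lab) P" by auto
      then have "list_mult G (map (val \<circ> lab') P) = \<one>" using disksD(5)[OF \<P> that] by argo
      moreover have "cyc p' P"
        unfolding p'_def using PZ d disksD(4)[OF \<P> that] by (intro cyc_insert_other) auto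
      ultimately show ?thesis using disksD(1-4)[OF \<P> that] unfolding disk_def by auto
    qed
    then have "disks G (val \<circ> lab') p' (insert d Z) \<P>" using \<P> unfolding disks_def by simp
    then show ?thesis using that by blast
  next
    case True
    then obtain P where P: "P \<in> \<P>" "e \<in> set P" by blast
    have vZ: "(val \<circ> lab) ` Z \<subseteq> carrier G"
      using car(1) t by (auto simp: Z_def)
    obtain A where A: "set (e # A) = set P" "distinct (e # A)" "cyc p (e # A)"
      "list_mult G (map (val \<circ> lab) (e # A)) = \<one>"
      using disks_rotate[OF \<P> vZ P] .
    have AZ: "set (e # A) \<subseteq> Z" using disksD(3)[OF \<P> P(1)] A(1) by simp
    have dA: "d \<notin> set (e # A)" using AZ d by blast
    define Q where "Q = e # d # A"
    have setQ: "set Q = insert d (set P)" unfolding Q_def A(1)[symmetric] by auto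
    have "disk G (val \<circ> lab') p' (insert d Z) Q"
      unfolding disk_def
    proof (intro conjI)
      show "Q \<noteq> []" by (simp add: Q_def)
      show "distinct Q" using A(2) dA by (auto simp: Q_def)
      show "set Q \<subseteq> insert d Z" using AZ by (auto simp: Q_def)
      show "cyc p' Q" unfolding Q_def p'_def using A(3) sd(2) dA A(2) by (rule cyc_insert)
      have "lab' x = lab x" if "x \<in> set A" for x using that A(2) AZ by (intro lab') auto
      then have mA: "map (val \<circ> lab') A = map (val \<circ> lab) A" by auto
      have cA: "set (map (val \<circ> lab) A) \<subseteq> carrier G" using vZ AZ by auto
      have "list_mult G (map (val \<circ> lab') Q) = val a \<otimes> (val b \<otimes> list_mult G (map (val \<circ> lab) A))"
        unfolding Q_def using lab'' by (simp add: list_mult_Cons mA)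
      also have "\<dots> = val c \<otimes> list_mult G (map (val \<circ> lab) A)"
        using ab(1) car list_mult_closed[OF cA] by (simp add: m_assoc)
      also have "\<dots> = \<one>" using A(4) t(2) by (simp add: list_mult_Cons)
      finally show "list_mult G (map (val \<circ> lab') Q) = \<one>" .
    qed
    moreover have eR: "e \<notin> set R" "d \<notin> set R" "set R \<inter> set P = {}" if "R \<in> \<P> - {P}" for R
    proof -
      show "set R \<inter> set P = {}" using that disks_disjoint[OF \<P> _ P(1)] by blast
      then show "e \<notin> set R" using P(2) by blast
      show "d \<notin> set R" using that disksD(3)[OF \<P>, of R] d by blast
    qed
    moreover have "disk G (val \<circ> lab') p' (insert d Z) R" if "R \<in> \<P> - {P}" for R
    proof -
      have R: "R \<in> \<P>" using that by simp
      have "lab' x = lab x" if "x \<in> set R" for x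
        using that eR(1)[OF \<open>R \<in> \<P> - {P}\<close>] disksD(3)[OF \<P> R] by (intro lab') auto
      then have "map (val \<circ> lab') R = map (val \<circ> lab) R" by auto
      then have "list_mult G (map (val \<circ> lab') R) = \<one>" using disksD(5)[OF \<P> R] by argo
      moreover have "cyc p' R"
        unfolding p'_def using eR[OF that] disksD(4)[OF \<P> R] by (intro cyc_insert_other)
      ultimately show ?thesis using disksD(1-4)[OF \<P> R] unfolding disk_def by auto
    qed
    moreover have "set Q \<inter> set R = {}" if "R \<in> \<P> - {P}" for R
      using eR[OF that] by (auto simp: setQ)
    ultimately have "disks G (val \<circ> lab') p' (insert d Z) (insert Q (\<P> - {P}))"
      using \<P> unfolding disks_def by (simp add: Int_commute)
    moreover have "card (insert Q (\<P> - {P})) = card \<P>"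
    proof -
      have "Q \<notin> \<P>" using disksD(3)[OF \<P>, of Q] d setQ by blast
      then have "card (insert Q (\<P> - {P})) = Suc (card (\<P> - {P}))" using fin by simp
      then show ?thesis using card_Suc_Diff1[OF fin P(1)] by simp
    qed
    ultimately show ?thesis using that by blast
  qed
  moreover have "card (h' ` insert d Z) = card (h ` Z) + 1"
  proof -
    have "h' ` insert d Z = insert k (h ` Z)"
    proof -
      have 1: "h' ` (Z - {e}) = h ` (Z - {e})" using d by (auto simp: h'_def)
      have 2: "insert d Z = insert e (insert d (Z - {e}))" using Z(3) by auto
      have 3: "h ` Z = insert (h e) (h ` (Z - {e}))" using Z(3) by auto
      have "h' e = k" "h' d = h e" using neq by (simp_all add: h'_def)
      then show ?thesis by (simp only: 1 2 3 image_insert)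
    qed
    then show ?thesis using k Z(2) by simp
  qed
  moreover have "card (insert d Z) = card Z + 1" using Z d by simp
  ultimately have "filling G (val \<circ> lab') (idx \<circ> lab') (insert d Z) s' \<chi>"
    unfolding filling_def using card perm(2)
    by (intro exI[of _ p'] exI[of _ h'] exI[of _ \<P>']) simp
  moreover have "set (concat [e # d # T]) = insert d Z" by (auto simp: Z_def)
  moreover have "cyc s' (e # d # T)"
    unfolding s'_def using ts(2,4) d sd by (intro cyc_insert) (auto simp: t Z_def)
  moreover have "map (map lab') [e # d # T] = [a # b # v]"
  proof -
    have "lab' x = lab x" if "x \<in> set T" for x
      using that ts(2) by (intro lab') (auto simp: Z_def t)
    then have "map lab' T = map lab T" by auto
    then show ?thesis using lab'' t by simp
  qed
  moreover have "distinct (concat [e # d # T])" using ts(2) d by (auto simp: t Z_def)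
  ultimately show ?thesis
    unfolding bounds_surface_def using perm(1)
    by (intro exI[of _ lab'] exI[of _ "[e # d # T]"] exI[of _ s']) simp
qed

end

section \<open>Counting on the boundary of a proper power\<close>

text \<open>With \<open>f\<close> the inverse of \<open>p\<close> after \<open>s\<close>, each
  ascent of \<open>ind\<close> along \<open>p\<close> comes from a point of \<open>A\<close>, and
  each colour contains an ascent along \<open>f\<close>, a point of \<open>B\<close>. The sets
  \<open>A\<close>, \<open>B\<close> and \<open>C\<close> are disjoint, because \<open>ind\<close>
  grows by at most 1 along \<open>s\<close> and returns to 0 after \<open>l - 1\<close>. The
  function \<open>c\<close> stands for the factor of a letter.\<close>

lemma card_ascents_plus_colours_le:
  fixes ind :: "'d \<Rightarrow> nat"
  assumes Z: "finite Z" and s: "s permutes Z" and p: "p permutes Z" and h: "compatible Z s p h"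
    and ind: "\<And>d. d \<in> Z \<Longrightarrow> ind d < l" "\<And>d. d \<in> Z \<Longrightarrow> ind (s d) = (ind d + 1) mod l"
    and c: "\<And>d. d \<in> Z \<Longrightarrow> c (ind (p d)) = c (ind d)" "\<And>d. d \<in> Z \<Longrightarrow> c (ind (s d)) \<noteq> c (ind d)"
  shows "card {d \<in> Z. ind d < ind (p d)} + card (h ` Z) + card {d \<in> Z. ind d = l - 1} \<le> card Z"
proof -
  define f where "f = inv_into UNIV p \<circ> s"
  have f: "f permutes Z" unfolding f_def using s permutes_inv[OF p] by (rule permutes_compose)
  have pf: "p (f d) = s d" for d by (simp add: f_def permutes_inverses[OF p])
  have fZ: "f d \<in> Z" if "d \<in> Z" for d using permutes_in_image[OF f] that by blast
  have hf: "h (f d) = h d" if "d \<in> Z" for d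
    using h fZ[OF that] that pf[of d] unfolding compatible_def by blast
  define A where "A = {d \<in> Z. ind (f d) < ind (s d)}"
  define B where "B = {d \<in> Z. ind d < ind (f d)}"
  define C where "C = {d \<in> Z. ind d = l - 1}"
  have fin: "finite A" "finite B" "finite C" using Z by (auto simp: A_def B_def C_def)
  have "{d \<in> Z. ind d < ind (p d)} \<subseteq> f ` A"
  proof
    fix x assume x: "x \<in> {d \<in> Z. ind d < ind (p d)}"
    then obtain y where "y \<in> Z" "x = f y" using permutes_image[OF f] by blast
    then show "x \<in> f ` A" using x pf[of y] by (auto simp: A_def)
  qed
  then have cA: "card {d \<in> Z. ind d < ind (p d)} \<le> card A"
    using fin(1) by (rule surj_card_le[rotated])
  have "h ` Z \<subseteq> h ` B"
  proof
    fix k assume "k \<in> h ` Z"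
    then obtain d where d: "d \<in> Z" "h d = k" by blast
    define K where "K = {y \<in> Z. h y = k}"
    have K: "finite K" "d \<in> K" using Z d by (auto simp: K_def)
    have "f ` K \<subseteq> K" using fZ hf by (auto simp: K_def)
    moreover have injK: "inj_on f K" using permutes_inj_on[OF f] .
    ultimately have fK: "f ` K = K" using K(1) by (simp add: endo_inj_surj)
    \<comment> \<open>As \<open>f\<close> permutes \<open>K\<close>, the sums of \<open>ind\<close>
      before and after \<open>f\<close> agree. Without an ascent \<open>ind\<close> would thus be
      constant along \<open>f\<close>, and \<open>c\<close> would agree at \<open>ind d\<close> and
      \<open>ind (s d)\<close>.\<close>
    have "\<exists>y \<in> K. ind y < ind (f y)"
    proof (rule ccontr)
      assume "\<not> ?thesis"
      then have le: "ind (f y) \<le> ind y" if "y \<in> K" for y using that by (simp add: not_less)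
      have "sum ind K = sum ind (f ` K)" by (simp only: fK)
      also have "\<dots> = (\<Sum>y\<in>K. ind (f y))" using injK by (simp add: sum.reindex)
      finally have "(\<Sum>y\<in>K. ind (f y)) = sum ind K" by simp
      then have "ind (f d) = ind d" using le K(2,1) by (rule sum_mono_inv)
      then show False using c(1)[OF fZ[OF d(1)]] c(2)[OF d(1)] pf[of d] by simp
    qed
    then show "k \<in> h ` B" by (auto simp: B_def K_def)
  qed
  then have cB: "card (h ` Z) \<le> card B"
    using fin(2) by (rule surj_card_le[rotated])
  have succ: "ind (s d) \<le> ind d + 1" if "d \<in> Z" for d using ind(2)[OF that] by simp
  have last: "ind (s d) = 0" if "d \<in> C" for d
    using that ind(1)[of d] ind(2)[of d] by (auto simp: C_def)
  \<comment> \<open>A common point would satisfy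
    \<open>ind d < ind (f d) < ind (s d) \<le> ind d + 1\<close>.\<close>
  have "A \<inter> B = {}" using succ by (fastforce simp: A_def B_def)
  moreover have "(A \<union> B) \<inter> C = {}"
  proof -
    have "d \<notin> A" if "d \<in> C" for d using last[OF that] by (simp add: A_def)
    moreover have "d \<notin> B" if "d \<in> C" for d
      using that ind(1)[OF fZ, of d] by (auto simp: B_def C_def)
    ultimately show ?thesis by blast
  qed
  ultimately have "card A + card B + card C = card (A \<union> B \<union> C)"
    using fin by (simp add: card_Un_disjoint)
  also have "\<dots> \<le> card Z" using Z by (intro card_mono) (auto simp: A_def B_def C_def)
  finally show ?thesis using cA cB unfolding C_def by simp
qed

lemma rotate1_fixed:
  assumes "rotate1 w = w" "x \<in> set w" "y \<in> set w"
  shows "x = y"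
proof -
  have r: "rotate n w = w" for n by (induction n) (simp_all add: assms(1))
  have "w ! i = hd w" if "i < length w" for i
  proof -
    have "w \<noteq> []" using that by auto
    then have "hd (rotate i w) = w ! (i mod length w)" by (rule hd_rotate_conv_nth)
    then show ?thesis using that r by simp
  qed
  then show ?thesis using assms(2,3) by (metis in_set_conv_nth)
qed

lemma card_mod_eq:
  assumes "i < (l :: nat)"
  shows "card {j. j < n * l \<and> j mod l = i} = n"
proof -
  have "bij_betw (\<lambda>q. q * l + i) {..<n} {j. j < n * l \<and> j mod l = i}"
  proof (rule bij_betwI[where g = "\<lambda>j. j div l"])
    show "(\<lambda>q. q * l + i) \<in> {..<n} \<rightarrow> {j. j < n * l \<and> j mod l = i}"
    proof
      fix q assume "q \<in> {..<n}"
      then have "(q + 1) * l \<le> n * l" by (intro mult_le_mono1) simp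
      then show "q * l + i \<in> {j. j < n * l \<and> j mod l = i}" using assms by simp
    qed
    show "(\<lambda>j. j div l) \<in> {j. j < n * l \<and> j mod l = i} \<rightarrow> {..<n}"
      using assms by (auto simp: less_mult_imp_div_less)
  qed (use assms in auto)
  then show ?thesis using bij_betw_same_card by fastforce
qed

lemma nth_concat_replicate:
  "j < n * length u \<Longrightarrow> concat (replicate n u) ! j = u ! (j mod length u)"
proof (induction n arbitrary: j)
  case (Suc n)
  then show ?case
    by (cases "j < length u") (auto simp: nth_append not_less le_mod_geq)
qed simp

lemma length_concat_replicate: "length (concat (replicate n u)) = n * length u"
  by (induction n) auto

context group
begin

lemma list_mult_replicate: "a \<in> carrier G \<Longrightarrow> list_mult G (replicate m a) = a [^] m"
proof (induction m)
  case (Suc m)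
  then show ?case using nat_pow_Suc2[of a m] by (simp add: list_mult_Cons)
qed (simp add: list_mult_Nil)

text \<open>Let \<open>ind\<close> be the position of a letter within its copy of \<open>u\<close>;
  each position occurs \<open>n\<close> times. Every disk contains an ascent of \<open>ind\<close>
  along \<open>p\<close>, so by the preceding count disks and colours together number at most
  \<open>card Z - n\<close>.\<close>

lemma bounds_surface_power_le:
  assumes sp: "bounds_surface G val idx \<chi> [concat (replicate n u)]"
    and u: "u \<noteq> []" "val ` set u \<subseteq> carrier G"
    and adj: "\<And>i. i < length u \<Longrightarrow> idx (u ! ((i + 1) mod length u)) \<noteq> idx (u ! i)"
    and tors: "\<And>a m. a \<in> set u \<Longrightarrow> 0 < m \<Longrightarrow> m \<le> n \<Longrightarrow> val a [^] m \<noteq> \<one>"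
  shows "\<chi> \<le> - int n"
proof -
  obtain lab :: "nat \<Rightarrow> _" and ts s where ts: "map (map lab) ts = [concat (replicate n u)]" "distinct (concat ts)"
    "s permutes set (concat ts)" "\<forall>t \<in> set ts. cyc s t"
    "filling G (val \<circ> lab) (idx \<circ> lab) (set (concat ts)) s \<chi>"
    using bounds_surfaceE[OF sp] by metis
  obtain t where t: "ts = [t]" "map lab t = concat (replicate n u)"
    using ts(1) by auto
  define Z l where "Z = set t" and "l = length u"
  define N where "N = n * l"
  have l: "0 < l" using u by (simp add: l_def)
  have lt: "length t = N"
    using arg_cong[OF t(2), of length] by (simp add: length_concat_replicate N_def l_def)
  have t': "distinct t" "cyc s t" "set (concat ts) = Z" "finite Z"
    using ts(2,4) by (simp_all add: t(1) Z_def)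
  have sZ: "s permutes Z" using ts(3) t' by simp
  obtain p h \<P> where p: "p permutes Z" "\<forall>x \<in> Z. (idx \<circ> lab) (p x) = (idx \<circ> lab) x"
    and h: "compatible Z s p h" and \<P>: "disks G (val \<circ> lab) p Z \<P>"
    and card: "int (card Z) + \<chi> \<le> int (card \<P>) + int (card (h ` Z))"
    using ts(5) unfolding filling_def t' by blast
  have bij: "bij_betw ((!) t) {..<N} Z"
    unfolding Z_def lt[symmetric] using t'(1) by (rule bij_betw_nth) auto
  define ind where "ind d = inv_into {..<N} ((!) t) d mod l" for d
  have ind_nth: "ind (t ! j) = j mod l" if "j < N" for j
    using bij_betw_inv_into_left[OF bij, of j] that by (simp add: ind_def)
  have Z_nth: "\<exists>j < N. d = t ! j" if "d \<in> Z" for d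
    using that lt by (metis Z_def in_set_conv_nth)
  have lab: "lab d = u ! ind d" if d: "d \<in> Z" for d
  proof -
    obtain j where j: "j < N" "d = t ! j" using Z_nth[OF d] by blast
    have "lab d = map lab t ! j" using j lt by simp
    also have "\<dots> = u ! (j mod l)"
      unfolding t(2) l_def by (rule nth_concat_replicate) (use j in \<open>simp add: N_def l_def\<close>)
    finally show ?thesis using ind_nth j by simp
  qed
  have ind_l: "ind d < l" for d using l by (simp add: ind_def)
  have ind_s: "ind (s d) = (ind d + 1) mod l" if d: "d \<in> Z" for d
  proof -
    obtain j where j: "j < N" "d = t ! j" using Z_nth[OF d] by blast
    have "s d = map s t ! j" using j lt by simp
    also have "\<dots> = t ! (Suc j mod N)"
      using t'(2) j lt by (simp add: cyc_def nth_rotate1)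
    finally have "ind (s d) = Suc j mod N mod l" using j by (simp add: ind_nth)
    \<comment> \<open>Wrapping round at the end of the whole power is harmless, because
      \<open>l\<close> divides \<open>N\<close>.\<close>
    also have "\<dots> = Suc j mod l" by (simp add: N_def mod_mod_cancel)
    finally show ?thesis using ind_nth j by (simp add: mod_Suc_eq)
  qed
  have pZ: "p d \<in> Z" if "d \<in> Z" for d using permutes_in_image[OF p(1)] that by blast
  have level: "card {d \<in> Z. ind d = i} = n" if "i < l" for i
  proof -
    have "{d \<in> Z. ind d = i} = (!) t ` {j. j < N \<and> j mod l = i}"
    proof (intro equalityI subsetI)
      fix d assume "d \<in> {d \<in> Z. ind d = i}"
      then obtain j where "j < N" "d = t ! j" "ind d = i" using Z_nth by blast
      then show "d \<in> (!) t ` {j. j < N \<and> j mod l = i}" using ind_nth by auto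
    next
      fix d assume "d \<in> (!) t ` {j. j < N \<and> j mod l = i}"
      then show "d \<in> {d \<in> Z. ind d = i}" using ind_nth lt by (auto simp: Z_def)
    qed
    moreover have "inj_on ((!) t) {j. j < N \<and> j mod l = i}"
      using bij_betw_imp_inj_on[OF bij] by (rule inj_on_subset) auto
    ultimately show ?thesis using card_mod_eq[OF that, of n] by (simp add: card_image N_def)
  qed
  have cZ: "card {d \<in> Z. ind d < ind (p d)} + card (h ` Z) + card {d \<in> Z. ind d = l - 1} \<le> card Z"
  proof (rule card_ascents_plus_colours_le[where ind = ind and c = "\<lambda>i. idx (u ! i)", OF t'(4) sZ p(1) h ind_l ind_s])
    fix d assume d: "d \<in> Z"
    have "idx (lab (p d)) = idx (lab d)" using p(2) d by simp
    then show "idx (u ! ind (p d)) = idx (u ! ind d)"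
      by (simp only: lab[OF d] lab[OF pZ[OF d]])
    show "idx (u ! ind (s d)) \<noteq> idx (u ! ind d)"
      using ind_s[OF d] adj[of "ind d"] ind_l[of d] by (simp add: l_def)
  qed
  have asc: "\<exists>x \<in> set P. ind x < ind (p x)" if P: "P \<in> \<P>" for P
  proof (rule ccontr)
    assume "\<not> ?thesis"
    then have le: "ind (p x) \<le> ind x" if "x \<in> set P" for x using that by (simp add: not_less)
    note D = disksD[OF \<P> P]
    have "inj_on p (set P)" using permutes_inj_on[OF p(1)] .
    then have "sum ind (p ` set P) = (\<Sum>x\<in>set P. ind (p x))" by (simp add: sum.reindex)
    then have "(\<Sum>x\<in>set P. ind (p x)) = sum ind (set P)" by (simp only: cyc_image[OF D(4)])
    then have eq: "ind (p x) = ind x" if "x \<in> set P" for x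
      \<comment> \<open>A termwise inequality between finite sums that are equal is an equality in
        every term.\<close>
      using le that finite_set by (rule sum_mono_inv)
    have "rotate1 (map ind P) = map ind (rotate1 P)" by (simp add: rotate1_map)
    also have "\<dots> = map ind (map p P)" using D(4) by (simp add: cyc_def)
    also have "\<dots> = map ind P" using eq by simp
    finally have "rotate1 (map ind P) = map ind P" .
    then have const: "ind x = ind (hd P)" if "x \<in> set P" for x
      using rotate1_fixed[of "map ind P" "ind x" "ind (hd P)"] that D(1) by simp
    define i where "i = ind (hd P)"
    have i: "i < length u" using ind_l by (simp add: i_def l_def)
    have a: "u ! i \<in> set u" "val (u ! i) \<in> carrier G" using i u(2) by auto
    have "map (val \<circ> lab) P = map (\<lambda>_. val (u ! i)) P"
      using const lab D(3) by (auto simp: i_def)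
    then have "map (val \<circ> lab) P = replicate (length P) (val (u ! i))"
      by (simp only: map_replicate_const)
    then have "val (u ! i) [^] length P = \<one>"
      using D(5) list_mult_replicate[OF a(2)] by simp
    \<comment> \<open>The sides of the disk are distinct points with the same value of
      \<open>ind\<close>, and only \<open>n\<close> points have it.\<close>
    moreover have "length P \<le> n"
    proof -
      have "length P = card (set P)" using D(2) by (simp add: distinct_card)
      also have "\<dots> \<le> card {d \<in> Z. ind d = i}"
        using D(3) const t'(4) by (intro card_mono) (auto simp: i_def)
      finally show ?thesis using level i by (simp add: l_def)
    qed
    ultimately show False using tors[OF a(1), of "length P"] D(1) by simp
  qed
  \<comment> \<open>Choosing an ascent in each disk is injective, since the disks are
    disjoint.\<close>
  then obtain x where x: "\<And>P. P \<in> \<P> \<Longrightarrow> x P \<in> set P \<and> ind (x P) < ind (p (x P))" by metis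
  have "inj_on x \<P>"
    using x disks_disjoint[OF \<P>] by (metis inj_onI)
  moreover have "x ` \<P> \<subseteq> {d \<in> Z. ind d < ind (p d)}"
    using x disksD(3)[OF \<P>] by auto
  ultimately have "card \<P> \<le> card {d \<in> Z. ind d < ind (p d)}"
    using t'(4) by (intro card_inj_on_le) auto
  then show ?thesis using cZ card level[of "l - 1"] l by simp
qed

end

section \<open>Words in a free product\<close>

lemma bounds_surface_mono:
  assumes "bounds_surface G val idx \<chi> ws" "\<chi>' \<le> \<chi>"
  shows "bounds_surface G val idx \<chi>' ws"
proof -
  have "filling G v i Z s \<chi> \<Longrightarrow> filling G v i Z s \<chi>'" for v i and Z :: "nat set" and s
    using assms(2) unfolding filling_def by fastforce
  then show ?thesis using assms(1) unfolding bounds_surface_def by blast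
qed

lemma bounds_surface_swap:
  assumes "bounds_surface G val idx \<chi> [u, v]"
  shows "bounds_surface G val idx \<chi> [v, u]"
proof -
  obtain lab :: "nat \<Rightarrow> _" and ts s where ts: "map (map lab) ts = [u, v]" "distinct (concat ts)"
    "s permutes set (concat ts)" "\<forall>t \<in> set ts. cyc s t"
    "filling G (val \<circ> lab) (idx \<circ> lab) (set (concat ts)) s \<chi>"
    using bounds_surfaceE[OF assms] by metis
  have "map (map lab) (rev ts) = [v, u]" using ts(1) by (simp add: rev_map[symmetric])
  moreover have "set (concat (rev ts)) = set (concat ts)" by simp
  moreover have "distinct (concat (rev ts))"
    using ts(1,2) by (auto simp: map_eq_Cons_conv)
  ultimately show ?thesis
    unfolding bounds_surface_def using ts(3-5)
    by (intro exI[of _ lab] exI[of _ "rev ts"] exI[of _ s]) simp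
qed

text \<open>The factors are all viewed inside the free product, so a single group can serve for
  every polygon. The factor of a letter is remembered by \<open>fst\<close>.\<close>

definition letter_value :: "('i \<Rightarrow> ('a, 'b) monoid_scheme) \<Rightarrow> 'i \<times> 'a \<Rightarrow> ('i \<times> 'a) list" where
  "letter_value G a = fp_incl G (fst a) (snd a)"

definition word_value :: "('i \<Rightarrow> ('a, 'b) monoid_scheme) \<Rightarrow> 'i set \<Rightarrow> ('i \<times> 'a) list \<Rightarrow> ('i \<times> 'a) list" where
  "word_value G I w = list_mult (free_product G I) (map (letter_value G) w)"

definition inv_word :: "('i \<Rightarrow> ('a, 'b) monoid_scheme) \<Rightarrow> ('i \<times> 'a) list \<Rightarrow> ('i \<times> 'a) list" where
  "inv_word G w = rev (map (\<lambda>(i, g). (i, inv\<^bsub>G i\<^esub> g)) w)"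

definition letters :: "('i \<Rightarrow> ('a, 'b) monoid_scheme) \<Rightarrow> 'i set \<Rightarrow> ('i \<times> 'a) set" where
  "letters G I = (SIGMA i:I. carrier (G i))"

definition proper_letters :: "('i \<Rightarrow> ('a, 'b) monoid_scheme) \<Rightarrow> 'i set \<Rightarrow> ('i \<times> 'a) set" where
  "proper_letters G I = (SIGMA i:I. carrier (G i) - {\<one>\<^bsub>G i\<^esub>})"

lemma proper_letters_subset: "proper_letters G I \<subseteq> letters G I"
  by (auto simp: proper_letters_def letters_def)

lemma reduced_words_letters: "w \<in> reduced_words G I \<Longrightarrow> set w \<subseteq> proper_letters G I"
  by (auto simp: reduced_words_def proper_letters_def)

lemma not_reduced_cases:
  assumes "set w \<subseteq> letters G I" "w \<notin> reduced_words G I"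
  obtains u i v where "w = u @ (i, \<one>\<^bsub>G i\<^esub>) # v"
  | u i g h v where "w = u @ (i, g) # (i, h) # v"
proof -
  have "(\<exists>u i v. w = u @ (i, \<one>\<^bsub>G i\<^esub>) # v) \<or> (\<exists>u i g h v. w = u @ (i, g) # (i, h) # v)"
    using assms
  proof (induction w)
    case Nil
    then show ?case by (simp add: reduced_words_Nil)
  next
    case (Cons a w)
    obtain i g where a: "a = (i, g)" by (cases a)
    show ?case
    proof (cases "w \<in> reduced_words G I")
      case False
      then have "(\<exists>u i v. w = u @ (i, \<one>\<^bsub>G i\<^esub>) # v) \<or> (\<exists>u i g h v. w = u @ (i, g) # (i, h) # v)"
        using Cons by simp
      then show ?thesis by (metis append_Cons)
    next
      case True
      have "i \<in> I" "g \<in> carrier (G i)" using Cons.prems(1) a by (auto simp: letters_def)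
      then have "g = \<one>\<^bsub>G i\<^esub> \<or> w \<noteq> [] \<and> fst (hd w) = i"
        using Cons.prems(2) True a by (auto simp: reduced_words_Cons)
      then show ?thesis
      proof
        assume "g = \<one>\<^bsub>G i\<^esub>"
        then have "a # w = [] @ (i, \<one>\<^bsub>G i\<^esub>) # w" using a by simp
        then show ?thesis by blast
      next
        assume "w \<noteq> [] \<and> fst (hd w) = i"
        then obtain h v where "w = (i, h) # v" by (cases w) auto
        then have "a # w = [] @ (i, g) # (i, h) # v" using a by simp
        then show ?thesis by blast
      qed
    qed
  qed
  then show ?thesis using that by blast
qed

section \<open>Values of letters and words in the free product\<close>

locale free_product_of_groups =
  fixes G :: "'i \<Rightarrow> ('a, 'b) monoid_scheme" and I :: "'i set"
  assumes factor: "\<And>i. i \<in> I \<Longrightarrow> group (G i)"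
begin

abbreviation "F \<equiv> free_product G I"

sublocale F: group F
  by (rule group_free_product) (rule factor)

lemma incl_hom: "i \<in> I \<Longrightarrow> fp_incl G i \<in> hom (G i) F"
  by (rule fp_incl_hom) (rule factor)

lemma letter_value_closed: "a \<in> letters G I \<Longrightarrow> letter_value G a \<in> carrier F"
  by (auto simp: letters_def letter_value_def intro!: hom_in_carrier[OF incl_hom])

lemma letter_values_closed: "set w \<subseteq> letters G I \<Longrightarrow> letter_value G ` set w \<subseteq> carrier F"
  using letter_value_closed by blast

lemma words_values_closed:
  "(\<Union>w \<in> set ws. set w) \<subseteq> letters G I \<Longrightarrow> \<forall>w \<in> set ws. letter_value G ` set w \<subseteq> carrier F"
  using letter_value_closed by blast

lemma letter_value_mult:
  assumes "(i, g) \<in> letters G I" "(i, h) \<in> letters G I"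
  shows "letter_value G (i, g \<otimes>\<^bsub>G i\<^esub> h) = letter_value G (i, g) \<otimes>\<^bsub>F\<^esub> letter_value G (i, h)"
  using hom_mult[OF incl_hom] assms by (simp add: letters_def letter_value_def)

lemma letter_value_inv:
  assumes "(i, g) \<in> letters G I"
  shows "letter_value G (i, inv\<^bsub>G i\<^esub> g) = inv\<^bsub>F\<^esub> (letter_value G (i, g))"
proof -
  have i: "i \<in> I" "g \<in> carrier (G i)" using assms by (auto simp: letters_def)
  interpret group_hom "G i" F "fp_incl G i"
    using factor[OF i(1)] incl_hom[OF i(1)] F.is_group
    by (simp add: group_hom_def group_hom_axioms_def)
  show ?thesis using hom_inv[OF i(2)] by (simp add: letter_value_def)
qed

lemma letter_value_pow:
  assumes "(i, g) \<in> letters G I"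
  shows "letter_value G (i, g [^]\<^bsub>G i\<^esub> (m :: nat)) = letter_value G (i, g) [^]\<^bsub>F\<^esub> m"
proof -
  have i: "i \<in> I" "g \<in> carrier (G i)" using assms by (auto simp: letters_def)
  interpret group_hom "G i" F "fp_incl G i"
    using factor[OF i(1)] incl_hom[OF i(1)] F.is_group
    by (simp add: group_hom_def group_hom_axioms_def)
  show ?thesis using hom_nat_pow[OF i(2)] by (simp add: letter_value_def)
qed

lemma letter_value_one: "letter_value G (i, g) = \<one>\<^bsub>F\<^esub> \<longleftrightarrow> g = \<one>\<^bsub>G i\<^esub>"
  by (simp add: letter_value_def fp_incl_def free_product_simps)

lemma word_value_Nil: "word_value G I [] = \<one>\<^bsub>F\<^esub>"
  by (simp add: word_value_def F.list_mult_Nil)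

lemma word_value_Cons: "word_value G I (a # w) = letter_value G a \<otimes>\<^bsub>F\<^esub> word_value G I w"
  by (simp add: word_value_def F.list_mult_Cons)

lemma word_value_closed: "set w \<subseteq> letters G I \<Longrightarrow> word_value G I w \<in> carrier F"
  unfolding word_value_def using letter_values_closed[of w] by (intro F.list_mult_closed) auto

lemma word_value_append:
  "set u \<subseteq> letters G I \<Longrightarrow> set v \<subseteq> letters G I \<Longrightarrow>
    word_value G I (u @ v) = word_value G I u \<otimes>\<^bsub>F\<^esub> word_value G I v"
  unfolding word_value_def map_append
  using letter_values_closed[of u] letter_values_closed[of v]
  by (intro F.list_mult_append) auto

lemma word_value_reduced: "w \<in> reduced_words G I \<Longrightarrow> word_value G I w = w"
proof (induction w)
  case Nil
  then show ?case by (simp add: word_value_Nil free_product_simps)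
next
  case (Cons a w)
  then show ?case
    by (cases a; cases w)
      (auto simp: word_value_Cons reduced_words_Cons letter_value_def fp_incl_def free_product_simps)
qed

text \<open>A nonempty word of value 1 is not reduced, and reducing it, read backwards, builds a
  disk: removing a trivial letter is undone by \<open>bounds_surface_insert_one\<close>, multiplying
  two letters by \<open>bounds_surface_split\<close>. The empty word is excluded, because without
  letters \<chi> cannot exceed 0.\<close>

lemma bounds_surface_word_value_one:
  assumes "w \<noteq> []" "set w \<subseteq> letters G I" "word_value G I w = \<one>\<^bsub>F\<^esub>"
  shows "bounds_surface F (letter_value G) fst 1 [w]"
  using assms
proof (induction w rule: length_induct)
  case (1 w)
  have "w \<notin> reduced_words G I"
    using 1(2,4) word_value_reduced[of w] by (auto simp: free_product_simps)
  from not_reduced_cases[OF 1(3) this] show ?case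
  proof cases
    case (1 u i v)
    note w = this
    have uv: "set u \<subseteq> letters G I" "set v \<subseteq> letters G I" "(i, \<one>\<^bsub>G i\<^esub>) \<in> letters G I"
      using \<open>set w \<subseteq> letters G I\<close> w by auto
    have one: "letter_value G (i, \<one>\<^bsub>G i\<^esub>) = \<one>\<^bsub>F\<^esub>" by (simp add: letter_value_one)
    show ?thesis
    proof (cases "v @ u")
      case Nil
      then show ?thesis using F.bounds_surface_single[of "letter_value G", OF one] w by simp
    next
      case (Cons a r)
      have "word_value G I u \<otimes>\<^bsub>F\<^esub> word_value G I v = \<one>\<^bsub>F\<^esub>"
        using \<open>word_value G I w = \<one>\<^bsub>F\<^esub>\<close> w uv
        by (simp add: word_value_append word_value_Cons one word_value_closed)
      then have "word_value G I (u @ v) = \<one>\<^bsub>F\<^esub>" using uv by (simp add: word_value_append)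
      moreover have "u @ v \<noteq> []" using Cons by auto
      moreover have "length (u @ v) < length w" using w by simp
      ultimately have "bounds_surface F (letter_value G) fst 1 [u @ v]"
        using "1.IH" uv by simp
      then have "bounds_surface F (letter_value G) fst 1 [v @ u]" by (rule bounds_surface_rotate)
      \<comment> \<open>Insertion takes place after the first letter, so the cyclic word is turned
        until the letter before the gap comes first.\<close>
      moreover obtain b q where q: "v @ u = q @ [b]" using Cons by (metis rev_exhaust list.discI)
      ultimately have "bounds_surface F (letter_value G) fst 1 [[b] @ q]"
        using bounds_surface_rotate[of F "letter_value G" fst 1 q "[b]" "[]"] by simp
      then have "bounds_surface F (letter_value G) fst 1 [b # (i, \<one>\<^bsub>G i\<^esub>) # q]"
        using F.bounds_surface_insert_one[where val = "letter_value G" and a = "(i, \<one>\<^bsub>G i\<^esub>)", OF _ one] by simp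
      then have "bounds_surface F (letter_value G) fst 1 [[b] @ ((i, \<one>\<^bsub>G i\<^esub>) # q)]" by simp
      then have "bounds_surface F (letter_value G) fst 1 [((i, \<one>\<^bsub>G i\<^esub>) # q) @ [b]]"
        by (rule bounds_surface_rotate)
      then have "bounds_surface F (letter_value G) fst 1 [((i, \<one>\<^bsub>G i\<^esub>) # v) @ u]" using q by simp
      then show ?thesis using bounds_surface_rotate w by blast
    qed
  next
    case (2 u i g h v)
    note w = this
    have uv: "set u \<subseteq> letters G I" "set v \<subseteq> letters G I" "(i, g) \<in> letters G I" "(i, h) \<in> letters G I"
      using \<open>set w \<subseteq> letters G I\<close> w by auto
    define c where "c = (i, g \<otimes>\<^bsub>G i\<^esub> h)"
    have c: "c \<in> letters G I" using uv group.is_monoid[OF factor]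
      by (auto simp: letters_def c_def intro: monoid.m_closed)
    have vc: "letter_value G c = letter_value G (i, g) \<otimes>\<^bsub>F\<^esub> letter_value G (i, h)"
      unfolding c_def using uv(3,4) by (rule letter_value_mult)
    have "word_value G I (u @ c # v) = word_value G I w"
      using uv c w
      by (simp add: word_value_append word_value_Cons vc F.m_assoc word_value_closed letter_value_closed)
    then have "bounds_surface F (letter_value G) fst 1 [u @ c # v]"
      using "1.IH" "1.prems" uv c w by simp
    then have "bounds_surface F (letter_value G) fst 1 [(c # v) @ u]" by (rule bounds_surface_rotate)
    then have "bounds_surface F (letter_value G) fst 1 [(i, g) # (i, h) # v @ u]"
      using uv c letter_values_closed[of "c # v @ u"]
      by (intro F.bounds_surface_split[where c = c]) (auto simp: letter_value_closed letter_value_mult c_def)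
    then show ?thesis using bounds_surface_rotate[of F _ _ _ "(i, g) # (i, h) # v" u] w by simp
  qed
qed

section \<open>Formal inverses, free cancellation and handles\<close>

lemma inv_word_simps:
  "inv_word G [] = []" "inv_word G ((i, g) # w) = inv_word G w @ [(i, inv\<^bsub>G i\<^esub> g)]"
  "inv_word G (u @ v) = inv_word G v @ inv_word G u"
  by (simp_all add: inv_word_def)

lemma set_inv_word: "set w \<subseteq> proper_letters G I \<Longrightarrow> set (inv_word G w) \<subseteq> proper_letters G I"
  using factor by (auto simp: inv_word_def proper_letters_def group.inv_eq_1_iff)

lemma inv_word_inv_word: "set w \<subseteq> proper_letters G I \<Longrightarrow> inv_word G (inv_word G w) = w"
  using factor
  by (induction w) (auto simp: inv_word_simps proper_letters_def)

lemma word_value_inv_word: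
  "set w \<subseteq> proper_letters G I \<Longrightarrow> word_value G I (inv_word G w) = inv\<^bsub>F\<^esub> (word_value G I w)"
proof (induction w)
  case Nil
  then show ?case by (simp add: inv_word_simps word_value_Nil)
next
  case (Cons a w)
  obtain i g where a: "a = (i, g)" by (cases a)
  have "set w \<subseteq> proper_letters G I" "(i, g) \<in> proper_letters G I" using Cons.prems a by auto
  then have w: "set w \<subseteq> letters G I" "set (inv_word G w) \<subseteq> letters G I" "(i, g) \<in> letters G I"
    using set_inv_word[of w] proper_letters_subset by blast+
  have ai: "(i, inv\<^bsub>G i\<^esub> g) \<in> letters G I" using w(3) factor by (auto simp: letters_def)
  show ?case
    using Cons w ai unfolding a
    by (simp add: inv_word_simps word_value_append word_value_Cons word_value_Nil letter_value_inv
        letter_value_closed word_value_closed F.inv_mult_group)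
qed

lemma inverse_letters_inv:
  assumes "(i, g) \<in> proper_letters G I"
  shows "F.inverse_letters (letter_value G) fst (i, g) (i, inv\<^bsub>G i\<^esub> g)"
    and "F.inverse_letters (letter_value G) fst (i, inv\<^bsub>G i\<^esub> g) (i, g)"
proof -
  have l: "(i, g) \<in> letters G I" using assms proper_letters_subset by blast
  moreover have "letter_value G (i, g) \<in> carrier F" using letter_value_closed[OF l] .
  moreover have "letter_value G (i, g) \<noteq> \<one>\<^bsub>F\<^esub>"
    using assms by (auto simp: proper_letters_def letter_value_one)
  ultimately show "F.inverse_letters (letter_value G) fst (i, g) (i, inv\<^bsub>G i\<^esub> g)"
    "F.inverse_letters (letter_value G) fst (i, inv\<^bsub>G i\<^esub> g) (i, g)"
    by (simp_all add: F.inverse_letters_def letter_value_inv F.inv_eq_1_iff)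
qed

text \<open>The innermost pair of letters is adjacent, whence the induction from the end of
  \<open>c\<close>. Folding it preserves \<chi> as long as other letters remain, which
  \<open>A\<close> guarantees.\<close>

lemma bounds_surface_cancel:
  assumes "bounds_surface F (letter_value G) fst \<chi> ((c @ inv_word G c @ A) # ws)" "A \<noteq> []"
    "set c \<subseteq> proper_letters G I" "set A \<subseteq> letters G I" "\<Union> (set ` set ws) \<subseteq> letters G I"
  shows "bounds_surface F (letter_value G) fst \<chi> (A # ws)"
  using assms(1,3)
proof (induction c rule: rev_induct)
  case Nil
  then show ?case by (simp add: inv_word_simps)
next
  case (snoc a c)
  obtain i g where a: "a = (i, g)" by (cases a)
  have c: "set c \<subseteq> proper_letters G I" "set (inv_word G c) \<subseteq> proper_letters G I"
    "(i, g) \<in> proper_letters G I" "(i, inv\<^bsub>G i\<^esub> g) \<in> proper_letters G I"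
    using snoc.prems(2) set_inv_word[of "c @ [a]"] a by (auto simp: inv_word_simps)
  then have cl: "set c \<subseteq> letters G I" "set (inv_word G c) \<subseteq> letters G I"
    "(i, g) \<in> letters G I" "(i, inv\<^bsub>G i\<^esub> g) \<in> letters G I"
    using proper_letters_subset by blast+
  have "bounds_surface F (letter_value G) fst \<chi> ((c @ ((i, g) # (i, inv\<^bsub>G i\<^esub> g) # inv_word G c @ A)) # ws)"
    using snoc.prems(1) a by (simp add: inv_word_simps)
  then have "bounds_surface F (letter_value G) fst \<chi> ((((i, g) # (i, inv\<^bsub>G i\<^esub> g) # inv_word G c @ A) @ c) # ws)"
    by (rule bounds_surface_rotate)
  then have "bounds_surface F (letter_value G) fst \<chi> (((i, g) # [] @ (i, inv\<^bsub>G i\<^esub> g) # inv_word G c @ A @ c) # ws)"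
    by simp
  then have "bounds_surface F (letter_value G) fst \<chi> ((inv_word G c @ A @ c) # ws)"
  proof (rule F.bounds_surface_cut(2)[OF _ words_values_closed])
    show "(\<Union>w \<in> set (((i, g) # [] @ (i, inv\<^bsub>G i\<^esub> g) # inv_word G c @ A @ c) # ws). set w)
        \<subseteq> letters G I"
      using cl assms(4,5) by simp
  qed (use inverse_letters_inv c(3) assms(2) in auto)
  then have "bounds_surface F (letter_value G) fst \<chi> (((inv_word G c @ A) @ c) # ws)" by simp
  then have "bounds_surface F (letter_value G) fst \<chi> ((c @ inv_word G c @ A) # ws)"
    by (rule bounds_surface_rotate)
  then show ?case using snoc by simp
qed

text \<open>Gluing the first letter of \<open>x\<close> to its inverse splits the boundary, and
  gluing the first letter of \<open>y\<close> to its inverse joins the two curves again. Each step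
  costs 1, and all other letters of \<open>x\<close> and \<open>y\<close> cancel freely.\<close>

lemma bounds_surface_handle:
  assumes sp: "bounds_surface F (letter_value G) fst \<chi> [inv_word G y @ inv_word G x @ y @ x @ A]"
    and A: "A \<noteq> []" "set A \<subseteq> letters G I"
    and x: "set x \<subseteq> proper_letters G I" and y: "set y \<subseteq> proper_letters G I"
  shows "bounds_surface F (letter_value G) fst (\<chi> - 2) [A]"
proof -
  have inv: "set (inv_word G x) \<subseteq> proper_letters G I" "set (inv_word G y) \<subseteq> proper_letters G I"
    using x y set_inv_word by auto
  have cancel: "bounds_surface F (letter_value G) fst \<chi>' (B # ws)"
    if "bounds_surface F (letter_value G) fst \<chi>' ((inv_word G c @ c @ B) # ws)" "B \<noteq> []" "set c \<subseteq> proper_letters G I"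
      "set B \<subseteq> letters G I" "\<Union> (set ` set ws) \<subseteq> letters G I" for \<chi>' c B ws
    using bounds_surface_cancel[of \<chi>' "inv_word G c" B ws] that inv_word_inv_word set_inv_word by simp
  \<comment> \<open>With \<open>x\<close> or \<open>y\<close> empty there is no letter to glue, but
    the handle then cancels freely and the bound is merely weakened.\<close>
  consider "x = []" | "y = []" | "x \<noteq> []" "y \<noteq> []" by blast
  then show ?thesis
  proof cases
    case 1
    then have "bounds_surface F (letter_value G) fst \<chi> [A]"
      using sp cancel[of \<chi> y A "[]"] A y by (simp add: inv_word_simps)
    then show ?thesis by (rule bounds_surface_mono) simp
  next
    case 2
    then have "bounds_surface F (letter_value G) fst \<chi> [A]"
      using sp cancel[of \<chi> x A "[]"] A x by (simp add: inv_word_simps)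
    then show ?thesis by (rule bounds_surface_mono) simp
  next
    case 3
    obtain i g X where X: "x = (i, g) # X" using 3(1) by (metis neq_Nil_conv surj_pair)
    obtain j h Y where Y: "y = (j, h) # Y" using 3(2) by (metis neq_Nil_conv surj_pair)
    define a' where "a' = (i, inv\<^bsub>G i\<^esub> g)"
    define b' where "b' = (j, inv\<^bsub>G j\<^esub> h)"
    have ix: "inv_word G x = inv_word G X @ [a']" and iy: "inv_word G y = inv_word G Y @ [b']"
      using X Y by (simp_all add: inv_word_simps a'_def b'_def)
    have L: "set x \<subseteq> letters G I" "set y \<subseteq> letters G I" "set (inv_word G x) \<subseteq> letters G I"
      "set (inv_word G y) \<subseteq> letters G I"
      using x y inv proper_letters_subset by blast+
    have LXY: "set X \<subseteq> letters G I" "set Y \<subseteq> letters G I" "set (inv_word G X) \<subseteq> letters G I"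
      "set (inv_word G Y) \<subseteq> letters G I" "a' \<in> letters G I" "b' \<in> letters G I" "(i, g) \<in> letters G I"
      "(j, h) \<in> letters G I"
      using L(1)[unfolded X] L(2)[unfolded Y] L(3)[unfolded ix] L(4)[unfolded iy] by auto
    have P: "set X \<subseteq> proper_letters G I" "set Y \<subseteq> proper_letters G I"
      "(i, g) \<in> proper_letters G I" "(j, h) \<in> proper_letters G I"
      using x y X Y by auto
    have "bounds_surface F (letter_value G) fst \<chi> [(inv_word G y @ inv_word G X) @ (a' # y @ (i, g) # X @ A)]"
      using sp[unfolded ix] by (simp add: X)
    then have "bounds_surface F (letter_value G) fst \<chi> [(a' # y @ (i, g) # X @ A) @ (inv_word G y @ inv_word G X)]"
      by (rule bounds_surface_rotate)
    then have "bounds_surface F (letter_value G) fst \<chi> [(a' # y @ (i, g) # (X @ A @ inv_word G y @ inv_word G X))]"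
      by simp
    then have "bounds_surface F (letter_value G) fst (\<chi> - 1) [y, X @ A @ inv_word G y @ inv_word G X]"
    proof (rule F.bounds_surface_cut(1))
      show "F.inverse_letters (letter_value G) fst a' (i, g)"
        unfolding a'_def using P by (intro inverse_letters_inv)
    qed (rule words_values_closed, use L LXY A in simp)
    then have "bounds_surface F (letter_value G) fst (\<chi> - 1) [X @ A @ inv_word G y @ inv_word G X, y]"
      by (rule bounds_surface_swap)
    then have "bounds_surface F (letter_value G) fst (\<chi> - 1) ((((X @ A @ inv_word G y) @ inv_word G X)) # [y])"
      by simp
    then have "bounds_surface F (letter_value G) fst (\<chi> - 1) ((inv_word G X @ X @ A @ inv_word G y) # [y])"
      by (rule bounds_surface_rotate)
    then have "bounds_surface F (letter_value G) fst (\<chi> - 1) ((A @ inv_word G y) # [y])"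
      by (rule cancel) (use A P L in auto)
    then have "bounds_surface F (letter_value G) fst (\<chi> - 1) (((A @ inv_word G Y) @ [b']) # [y])"
      by (simp add: iy)
    then have "bounds_surface F (letter_value G) fst (\<chi> - 1) (([b'] @ (A @ inv_word G Y)) # [y])"
      by (rule bounds_surface_rotate)
    \<comment> \<open>The letter \<open>b'\<close> and its inverse, the first letter of
      \<open>y\<close>, now lie on different boundary curves.\<close>
    then have "bounds_surface F (letter_value G) fst (\<chi> - 1) ((b' # (A @ inv_word G Y)) # ((j, h) # Y) # [])"
      by (simp add: Y)
    then have "bounds_surface F (letter_value G) fst (\<chi> - 1 - 1) [(A @ inv_word G Y) @ Y]"
    proof (rule F.bounds_surface_join)
      show "F.inverse_letters (letter_value G) fst b' (j, h)"
        unfolding b'_def using P by (intro inverse_letters_inv)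
    qed (rule words_values_closed, use L LXY A in simp)
    then have "bounds_surface F (letter_value G) fst (\<chi> - 1 - 1) [A @ (inv_word G Y @ Y)]" by simp
    then have "bounds_surface F (letter_value G) fst (\<chi> - 1 - 1) [(inv_word G Y @ Y) @ A]"
      by (rule bounds_surface_rotate)
    then have "bounds_surface F (letter_value G) fst (\<chi> - 1 - 1) [inv_word G Y @ Y @ A]" by simp
    then have "bounds_surface F (letter_value G) fst (\<chi> - 1 - 1) [A]"
      by (rule cancel) (use A P in auto)
    then show ?thesis by simp
  qed
qed

end

section \<open>Products of commutators that are proper powers\<close>

context free_product_of_groups
begin

lemma length_fp_cons_le: "length (fp_cons G a w) \<le> length w + 1"
  by (cases a; cases w) (auto simp: fp_incl_def)

lemma length_fp_mult_le: "length (foldr (fp_cons G) u w) \<le> length u + length w"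
proof (induction u)
  case (Cons a u)
  then show ?case using length_fp_cons_le[of a "foldr (fp_cons G) u w"] by simp
qed simp

text \<open>If the first and last letters lie in one factor, conjugation by the first letter makes
  them merge, which shortens the word. A nonempty \<open>I\<close> supplies a factor for the trivial
  element.\<close>

lemma cyclic_reduction:
  assumes "z \<in> carrier F" "I \<noteq> {}"
  shows "(\<exists>i \<in> I. \<exists>g \<in> carrier (G i). conjugate_in F z (fp_incl G i g)) \<or>
    (\<exists>u \<in> carrier F. 2 \<le> length u \<and> fst (hd u) \<noteq> fst (last u) \<and> conjugate_in F z u)"
  using assms(1)
proof (induction z rule: length_induct)
  case (1 z)
  have z: "z \<in> reduced_words G I" using "1.prems" by (simp add: free_product_simps)
  have refl: "conjugate_in F z z"
    unfolding conjugate_in_def using "1.prems" by (intro bexI[of _ "\<one>\<^bsub>F\<^esub>"]) simp_all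
  consider "z = []" | i g where "z = [(i, g)]" | "2 \<le> length z" "fst (hd z) \<noteq> fst (last z)"
    | "2 \<le> length z" "fst (hd z) = fst (last z)"
    by (cases z rule: remdups_adj.cases) auto
  then show ?case
  proof cases
    case 1
    obtain i where i: "i \<in> I" using assms(2) by blast
    have "fp_incl G i \<one>\<^bsub>G i\<^esub> = z" "\<one>\<^bsub>G i\<^esub> \<in> carrier (G i)"
      using 1 group.is_monoid[OF factor[OF i]] by (auto simp: fp_incl_def intro: monoid.one_closed)
    then show ?thesis using refl i by metis
  next
    case (2 i g)
    then have "i \<in> I" "g \<in> carrier (G i)" "fp_incl G i g = z"
      using z by (auto simp: reduced_words_Cons fp_incl_def)
    then show ?thesis using refl by metis
  next
    case 3
    then show ?thesis using refl "1.prems" by blast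
  next
    case 4
    obtain a v where v: "z = a # v" "v \<noteq> []"
      using 4(1) by (cases z rule: remdups_adj.cases) auto
    obtain i g where a: "a = (i, g)" by (cases a)
    obtain v' b where v': "v = v' @ [b]" using v(2) by (metis rev_exhaust)
    obtain h where b: "b = (i, h)" using 4(2) v v' a by (cases b) auto
    define q where "q = [(i, g)]"
    have q: "q \<in> carrier F" "v \<in> carrier F"
      using z v a by (auto simp: q_def free_product_simps reduced_words_Cons reduced_words_Nil)
    have zqv: "z = q \<otimes>\<^bsub>F\<^esub> v"
      using z v a by (cases v) (auto simp: q_def free_product_simps reduced_words_Cons fp_incl_def)
    define z' where "z' = v \<otimes>\<^bsub>F\<^esub> q"
    have z': "z' \<in> carrier F" using q by (simp add: z'_def)
    have "z' = foldr (fp_cons G) v' (fp_incl G i (h \<otimes>\<^bsub>G i\<^esub> g))"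
      by (simp add: z'_def v' b q_def free_product_simps)
    then have "length z' \<le> length v' + length (fp_incl G i (h \<otimes>\<^bsub>G i\<^esub> g))"
      using length_fp_mult_le by simp
    also have "\<dots> < length z" using v v' by (simp add: fp_incl_def)
    finally have IH: "(\<exists>i \<in> I. \<exists>g \<in> carrier (G i). conjugate_in F z' (fp_incl G i g)) \<or>
        (\<exists>u \<in> carrier F. 2 \<le> length u \<and> fst (hd u) \<noteq> fst (last u) \<and> conjugate_in F z' u)"
      using "1.IH" z' by blast
    have trans: "conjugate_in F z u" if "conjugate_in F z' u" "u \<in> carrier F" for u
    proof -
      obtain c where c: "c \<in> carrier F" "z' = inv\<^bsub>F\<^esub> c \<otimes>\<^bsub>F\<^esub> u \<otimes>\<^bsub>F\<^esub> c"
        using \<open>conjugate_in F z' u\<close> unfolding conjugate_in_def by blast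
      have "z = q \<otimes>\<^bsub>F\<^esub> z' \<otimes>\<^bsub>F\<^esub> inv\<^bsub>F\<^esub> q"
        using q by (simp add: zqv z'_def F.m_assoc)
      also have "\<dots> = inv\<^bsub>F\<^esub> (c \<otimes>\<^bsub>F\<^esub> inv\<^bsub>F\<^esub> q) \<otimes>\<^bsub>F\<^esub> u \<otimes>\<^bsub>F\<^esub> (c \<otimes>\<^bsub>F\<^esub> inv\<^bsub>F\<^esub> q)"
        using q c that(2) by (simp add: F.inv_mult_group F.m_assoc)
      finally show ?thesis
        unfolding conjugate_in_def
        by (rule bexI[of _ "c \<otimes>\<^bsub>F\<^esub> inv\<^bsub>F\<^esub> q"]) (use q c in simp)
    qed
    have "fp_incl G i g \<in> carrier F" if "i \<in> I" "g \<in> carrier (G i)" for i g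
      using that by (intro hom_in_carrier[OF incl_hom])
    then show ?thesis using IH trans by metis
  qed
qed

text \<open>The order of the factors is that of the inverse of the commutator of \<open>x\<close> and \<open>y\<close>.\<close>

definition handle_word :: "('i \<times> 'a) list \<Rightarrow> ('i \<times> 'a) list \<Rightarrow> ('i \<times> 'a) list" where
  "handle_word x y = inv_word G y @ inv_word G x @ y @ x"

lemma carrier_letters: "w \<in> carrier F \<Longrightarrow> set w \<subseteq> proper_letters G I"
  using reduced_words_letters[of w G I] by (simp add: free_product_simps)

lemma handle_word_letters:
  assumes "x \<in> carrier F" "y \<in> carrier F"
  shows "set (handle_word x y) \<subseteq> letters G I"
proof -
  have "set (handle_word x y) \<subseteq> proper_letters G I"
    using carrier_letters[OF assms(1)] carrier_letters[OF assms(2)] set_inv_word[of x] set_inv_word[of y]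
    unfolding handle_word_def by simp
  then show ?thesis using proper_letters_subset by blast
qed

lemma handle_words_letters:
  assumes "\<And>i. i \<in> set js \<Longrightarrow> x i \<in> carrier F" "\<And>i. i \<in> set js \<Longrightarrow> y i \<in> carrier F"
  shows "set (concat (map (\<lambda>i. handle_word (x i) (y i)) js)) \<subseteq> letters G I"
proof
  fix a assume "a \<in> set (concat (map (\<lambda>i. handle_word (x i) (y i)) js))"
  then obtain i where "i \<in> set js" "a \<in> set (handle_word (x i) (y i))" by auto
  then show "a \<in> letters G I" using handle_word_letters[of "x i" "y i"] assms by blast
qed

lemma word_value_handle_word:
  assumes "x \<in> carrier F" "y \<in> carrier F"
  shows "word_value G I (handle_word x y) = inv\<^bsub>F\<^esub> (commutator F x y)"
proof -
  have p: "set x \<subseteq> proper_letters G I" "set y \<subseteq> proper_letters G I"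
    using carrier_letters assms by blast+
  then have "set (inv_word G x) \<subseteq> proper_letters G I" "set (inv_word G y) \<subseteq> proper_letters G I"
    using set_inv_word by blast+
  then have l: "set x \<subseteq> letters G I" "set y \<subseteq> letters G I" "set (inv_word G x) \<subseteq> letters G I"
    "set (inv_word G y) \<subseteq> letters G I"
    using p proper_letters_subset by blast+
  have v: "word_value G I x = x" "word_value G I y = y"
    using assms by (auto simp: free_product_simps intro: word_value_reduced)
  have "word_value G I (handle_word x y) = inv\<^bsub>F\<^esub> y \<otimes>\<^bsub>F\<^esub> (inv\<^bsub>F\<^esub> x \<otimes>\<^bsub>F\<^esub> (y \<otimes>\<^bsub>F\<^esub> x))"
    using l p unfolding handle_word_def by (simp add: word_value_append word_value_inv_word v)
  also have "\<dots> = inv\<^bsub>F\<^esub> (commutator F x y)"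
    using assms by (simp add: commutator_def F.inv_mult_group F.m_assoc)
  finally show ?thesis .
qed

text \<open>Inversion reverses the order of a product, so the handles are listed from last to
  first.\<close>

lemma word_value_handles:
  assumes "\<And>i. i \<in> set js \<Longrightarrow> x i \<in> carrier F" "\<And>i. i \<in> set js \<Longrightarrow> y i \<in> carrier F"
  shows "word_value G I (concat (map (\<lambda>i. handle_word (x i) (y i)) (rev js))) =
    inv\<^bsub>F\<^esub> (list_mult F (map (\<lambda>i. commutator F (x i) (y i)) js))"
  using assms
proof (induction js)
  case Nil
  then show ?case by (simp add: word_value_Nil F.list_mult_Nil)
next
  case (Cons j js)
  have c: "commutator F (x i) (y i) \<in> carrier F" if "i \<in> set (j # js)" for i
    using Cons.prems that by (simp add: commutator_def)
  have "set (map (\<lambda>i. commutator F (x i) (y i)) js) \<subseteq> carrier F" using c by auto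
  then have l: "list_mult F (map (\<lambda>i. commutator F (x i) (y i)) js) \<in> carrier F"
    by (rule F.list_mult_closed)
  have "set (concat (map (\<lambda>i. handle_word (x i) (y i)) (rev js))) \<subseteq> letters G I"
    by (rule handle_words_letters) (use Cons.prems in auto)
  moreover have "set (handle_word (x j) (y j)) \<subseteq> letters G I"
    using handle_word_letters Cons.prems by simp
  ultimately show ?case
    using Cons c l by (simp add: word_value_append word_value_handle_word F.list_mult_Cons F.inv_mult_group)
qed

lemma bounds_surface_handles:
  assumes "bounds_surface F (letter_value G) fst \<chi> [concat (map (\<lambda>i. handle_word (x i) (y i)) js) @ A]"
    and "A \<noteq> []" "set A \<subseteq> letters G I"
    and "\<And>i. i \<in> set js \<Longrightarrow> x i \<in> carrier F" "\<And>i. i \<in> set js \<Longrightarrow> y i \<in> carrier F"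
  shows "bounds_surface F (letter_value G) fst (\<chi> - 2 * int (length js)) [A]"
  using assms(1,4,5)
proof (induction js arbitrary: \<chi>)
  case Nil
  then show ?case by simp
next
  case (Cons j js)
  let ?B = "concat (map (\<lambda>i. handle_word (x i) (y i)) js) @ A"
  have "bounds_surface F (letter_value G) fst (\<chi> - 2) [?B]"
  proof (rule bounds_surface_handle)
    show "bounds_surface F (letter_value G) fst \<chi>
        [inv_word G (y j) @ inv_word G (x j) @ y j @ x j @ ?B]"
      using Cons.prems(1) by (simp add: handle_word_def)
    show "set ?B \<subseteq> letters G I"
      using handle_words_letters[of js x y] Cons.prems(2,3) assms(3) by simp
    show "set (x j) \<subseteq> proper_letters G I" "set (y j) \<subseteq> proper_letters G I"
      using Cons.prems(2,3) by (simp_all add: carrier_letters)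
  qed (use assms(2) in simp)
  then have "bounds_surface F (letter_value G) fst (\<chi> - 2 - 2 * int (length js)) [A]"
    using Cons by simp
  then show ?case by (simp add: algebra_simps)
qed

lemma word_value_power:
  assumes "u \<in> carrier F"
  shows "word_value G I (concat (replicate n u)) = u [^]\<^bsub>F\<^esub> n"
proof (induction n)
  case 0
  then show ?case by (simp add: word_value_Nil)
next
  case (Suc n)
  have "set u \<subseteq> letters G I" using carrier_letters[OF assms] proper_letters_subset by blast
  moreover from this have "set (concat (replicate n u)) \<subseteq> letters G I" by auto
  ultimately have "word_value G I (concat (replicate (Suc n) u)) = u \<otimes>\<^bsub>F\<^esub> u [^]\<^bsub>F\<^esub> n"
    using Suc assms by (simp add: word_value_append word_value_reduced free_product_simps)
  then show ?case using F.nat_pow_Suc2[OF assms, of n] by simp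
qed

text \<open>The handle words spell the inverse of the left side of the equation. Followed by the
  conjugated power they form a word of value 1, which bounds a disk. Removing each handle costs 2,
  and the conjugating word \<open>c\<close> cancels after a rotation at no cost.\<close>

lemma bounds_surface_power_of_commutators:
  assumes xy: "\<And>i. i \<in> set js \<Longrightarrow> x i \<in> carrier F" "\<And>i. i \<in> set js \<Longrightarrow> y i \<in> carrier F"
    and u: "u \<in> carrier F" "u \<noteq> []" and c: "c \<in> carrier F" and n: "0 < n"
    and eq: "list_mult F (map (\<lambda>i. commutator F (x i) (y i)) js) =
      (inv\<^bsub>F\<^esub> c \<otimes>\<^bsub>F\<^esub> u \<otimes>\<^bsub>F\<^esub> c) [^]\<^bsub>F\<^esub> n"
  shows "bounds_surface F (letter_value G) fst (1 - 2 * int (length js)) [concat (replicate n u)]"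
proof -
  define U where "U = concat (replicate n u)"
  define H where "H = concat (map (\<lambda>i. handle_word (x i) (y i)) (rev js))"
  have p: "set u \<subseteq> proper_letters G I" "set c \<subseteq> proper_letters G I" "set (inv_word G c) \<subseteq> proper_letters G I"
    using carrier_letters u c set_inv_word by blast+
  then have l: "set U \<subseteq> letters G I" "set c \<subseteq> letters G I" "set (inv_word G c) \<subseteq> letters G I"
    using proper_letters_subset[of G I] by (auto simp: U_def)
  have lH: "set H \<subseteq> letters G I"
    unfolding H_def by (rule handle_words_letters) (use xy in auto)
  have U: "U \<noteq> []" using u(2) n by (auto simp: U_def)
  have pow: "(inv\<^bsub>F\<^esub> c \<otimes>\<^bsub>F\<^esub> u \<otimes>\<^bsub>F\<^esub> c) [^]\<^bsub>F\<^esub> m = inv\<^bsub>F\<^esub> c \<otimes>\<^bsub>F\<^esub> u [^]\<^bsub>F\<^esub> m \<otimes>\<^bsub>F\<^esub> c" for m :: nat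
  proof (induction m)
    case 0
    then show ?case using c by simp
  next
    case (Suc m)
    have "c \<otimes>\<^bsub>F\<^esub> (inv\<^bsub>F\<^esub> c \<otimes>\<^bsub>F\<^esub> w) = w" if "w \<in> carrier F" for w
      using c that by (simp add: F.m_assoc[symmetric])
    then show ?case using Suc c u by (simp add: F.m_assoc)
  qed
  have vc: "word_value G I c = c" using c by (simp add: word_value_reduced free_product_simps)
  have vH: "word_value G I H = inv\<^bsub>F\<^esub> (inv\<^bsub>F\<^esub> c \<otimes>\<^bsub>F\<^esub> u [^]\<^bsub>F\<^esub> n \<otimes>\<^bsub>F\<^esub> c)"
    unfolding H_def by (simp only: word_value_handles[OF xy] eq pow)
  have "word_value G I (inv_word G c @ U @ c) = inv\<^bsub>F\<^esub> c \<otimes>\<^bsub>F\<^esub> u [^]\<^bsub>F\<^esub> n \<otimes>\<^bsub>F\<^esub> c"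
    using l p c u by (simp add: word_value_append word_value_inv_word vc U_def[symmetric] F.m_assoc)
      (simp add: U_def word_value_power)
  then have "word_value G I (H @ inv_word G c @ U @ c) = \<one>\<^bsub>F\<^esub>"
    using l lH c u word_value_append[OF lH, of "inv_word G c @ U @ c"] vH by simp
  then have "bounds_surface F (letter_value G) fst 1 [H @ (inv_word G c @ U @ c)]"
    using l lH U by (intro bounds_surface_word_value_one) auto
  then have "bounds_surface F (letter_value G) fst (1 - 2 * int (length (rev js))) [inv_word G c @ U @ c]"
    unfolding H_def by (rule bounds_surface_handles) (use l U xy in auto)
  then have "bounds_surface F (letter_value G) fst (1 - 2 * int (length js)) [(inv_word G c @ U) @ c]"
    by simp
  then have "bounds_surface F (letter_value G) fst (1 - 2 * int (length js)) [c @ (inv_word G c @ U)]"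
    by (rule bounds_surface_rotate)
  then show ?thesis
    unfolding U_def[symmetric] by (rule bounds_surface_cancel) (use U l p in auto)
qed

text \<open>A cyclically reduced conjugate \<open>u\<close> of length at least 2 would bound \<chi>
  from both sides: \<open>1 - 2 * length js \<le> - n\<close>, against
  \<open>2 * length js \<le> n\<close>.\<close>

theorem commutators_power_conjugate_into_factor:
  assumes xy: "\<And>i. i \<in> set js \<Longrightarrow> x i \<in> carrier F" "\<And>i. i \<in> set js \<Longrightarrow> y i \<in> carrier F"
    and z: "z \<in> carrier F" and I: "I \<noteq> {}" and n: "0 < n" "2 * length js \<le> n"
    and tors: "\<And>i g m. i \<in> I \<Longrightarrow> g \<in> carrier (G i) \<Longrightarrow> g \<noteq> \<one>\<^bsub>G i\<^esub> \<Longrightarrow> 0 < m \<Longrightarrow> m \<le> n \<Longrightarrow>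
      g [^]\<^bsub>G i\<^esub> (m :: nat) \<noteq> \<one>\<^bsub>G i\<^esub>"
    and eq: "list_mult F (map (\<lambda>i. commutator F (x i) (y i)) js) = z [^]\<^bsub>F\<^esub> n"
  shows "\<exists>i \<in> I. \<exists>g \<in> carrier (G i). conjugate_in F z (fp_incl G i g)"
proof (rule ccontr)
  assume "\<not> ?thesis"
  then obtain u where u: "u \<in> carrier F" "2 \<le> length u" "fst (hd u) \<noteq> fst (last u)" "conjugate_in F z u"
    using cyclic_reduction[OF z I] by blast
  obtain c where c: "c \<in> carrier F" "z = inv\<^bsub>F\<^esub> c \<otimes>\<^bsub>F\<^esub> u \<otimes>\<^bsub>F\<^esub> c"
    using u(4) unfolding conjugate_in_def by blast
  have "u \<noteq> []" using u(2) by auto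
  have pl: "set u \<subseteq> proper_letters G I" using carrier_letters[OF u(1)] .
  have sp: "bounds_surface F (letter_value G) fst (1 - 2 * int (length js)) [concat (replicate n u)]"
    using bounds_surface_power_of_commutators[OF xy u(1) \<open>u \<noteq> []\<close> c(1) n(1)] eq c(2) by simp
  have "1 - 2 * int (length js) \<le> - int n"
  proof (rule F.bounds_surface_power_le[OF sp \<open>u \<noteq> []\<close>])
    show "letter_value G ` set u \<subseteq> carrier F"
      using pl proper_letters_subset by (intro letter_values_closed) blast
  next
    fix i assume i: "i < length u"
    have succ: "successively (\<lambda>p q. fst p \<noteq> fst q) u"
      using u(1) by (simp add: free_product_simps reduced_words_def)
    show "fst (u ! ((i + 1) mod length u)) \<noteq> fst (u ! i)"
    proof (cases "i + 1 < length u")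
      case True
      then show ?thesis using succ by (fastforce simp: successively_conv_nth)
    next
      case False
      \<comment> \<open>The step from the last letter back to the first is where cyclic reducedness
        is used.\<close>
      then have "i = length u - 1" "i + 1 = length u" using i by auto
      then show ?thesis using u(3) \<open>u \<noteq> []\<close> by (simp add: hd_conv_nth last_conv_nth)
    qed
  next
    fix a m assume a: "a \<in> set u" and m: "0 < m" "m \<le> n"
    obtain i g where ig: "a = (i, g)" by (cases a)
    have g: "i \<in> I" "g \<in> carrier (G i)" "g \<noteq> \<one>\<^bsub>G i\<^esub>" "(i, g) \<in> letters G I"
      using pl a ig by (auto simp: proper_letters_def letters_def)
    have "letter_value G (i, g [^]\<^bsub>G i\<^esub> m) \<noteq> \<one>\<^bsub>F\<^esub>"
      using tors[OF g(1-3) m] by (simp add: letter_value_one)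
    then show "letter_value G a [^]\<^bsub>F\<^esub> m \<noteq> \<one>\<^bsub>F\<^esub>"
      using letter_value_pow[OF g(4)] ig by simp
  qed
  then show False using n(2) by simp
qed

end

theorem corollary1:
  fixes G :: "'i \<Rightarrow> ('a, 'b) monoid_scheme" and I :: "'i set"
    and k n :: nat
    and F :: "('i \<times> 'a) list monoid"
    and x y :: "nat \<Rightarrow> ('i \<times> 'a) list" and z :: "('i \<times> 'a) list"
  defines "F \<equiv> free_product G I"
  assumes "0 < k" and "0 < n" and "2 * k \<le> n"
    and "I \<noteq> {}"
    and "\<And>\<alpha>. \<alpha> \<in> I \<Longrightarrow> group (G \<alpha>)"
    and "\<And>\<alpha>. \<alpha> \<in> I \<Longrightarrow>
      \<not> (\<exists>g \<in> carrier (G \<alpha>). g \<noteq> \<one>\<^bsub>G \<alpha>\<^esub> \<and> 0 < group.ord (G \<alpha>) g \<and> group.ord (G \<alpha>) g \<le> n)"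
    and "\<And>i. i \<in> {1..k} \<Longrightarrow> x i \<in> carrier F"
    and "\<And>i. i \<in> {1..k} \<Longrightarrow> y i \<in> carrier F"
    and "z \<in> carrier F"
    and "list_mult F (map (\<lambda>i. commutator F (x i) (y i)) [1..<k+1]) = z [^]\<^bsub>F\<^esub> n"
  shows "\<exists>\<alpha> \<in> I. \<exists>g \<in> carrier (G \<alpha>). conjugate_in F z (fp_incl G \<alpha> g)"
proof -
  interpret free_product_of_groups G I
    using assms(6) by (rule free_product_of_groups.intro)
  have js: "set [1..<k+1] = {1..k}" "length [1..<k+1] = k" by auto
  have torsion: "g [^]\<^bsub>G i\<^esub> m \<noteq> \<one>\<^bsub>G i\<^esub>"
    if "i \<in> I" "g \<in> carrier (G i)" "g \<noteq> \<one>\<^bsub>G i\<^esub>" "0 < m" "m \<le> n" for i g and m :: nat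
  proof
    assume one: "g [^]\<^bsub>G i\<^esub> m = \<one>\<^bsub>G i\<^esub>"
    interpret Gi: group "G i" using assms(6) that(1) .
    \<comment> \<open>Elements of infinite order have \<open>ord\<close> equal to 0; dividing the
      positive \<open>m\<close> excludes this value.\<close>
    have "Gi.ord g dvd m" using one Gi.pow_eq_id[OF that(2)] by simp
    then have "0 < Gi.ord g" "Gi.ord g \<le> m" using that(4) by (auto intro: dvd_pos_nat dvd_imp_le)
    then show False using assms(7)[OF that(1)] that by auto
  qed
  have xy: "x i \<in> carrier (free_product G I)" "y i \<in> carrier (free_product G I)"
    if "i \<in> set [1..<k+1]" for i
    using assms(8,9) that unfolding js F_def by blast+
  show ?thesis
    unfolding F_def
    by (rule commutators_power_conjugate_into_factor[OF xy assms(10)[unfolded F_def] assms(5,3) _ torsion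
          assms(11)[unfolded F_def]])
      (simp_all only: js assms(4) not_False_eq_True)
qed

end
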